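(* Let $\boldsymbol Y(t)=(Y_1(t),\ldots,Y_d(t))$, $t\in\mathcal T=\mathbb R^p$, be an $\mathbb R^d$-valued Gaussian process with centered components and continuous sample paths, and let $\boldsymbol X$ be the Brown-Resnick max-stable process, i.e. the max-stable process with index $\alpha=1$ and spectral process $$\boldsymbol Z(t)=\Bigl(e^{Y_1(t)-\mathrm{Var}(Y_1(t))/2},\ldots,e^{Y_d(t)-\mathrm{Var}(Y_d(t))/2}\Bigr),\qquad t\in\mathcal T .$$ Then the law of $\boldsymbol X$ depends only on the matrix-valued function with $ij$th entry $\gamma_{ij}(t,s)=\mathrm{Var}(Y_i(t)-Y_j(s))$, $s,t\in\mathcal T$, $1\le i,j\le d$ (that is, two such Gaussian processes with the same functions $\gamma_{ij}$, $1\le i,j\le d$, yield Brown-Resnick processes with the same law). In particular, if $\gamma_{ij}(t,s)$, $i,j\le d$, depend only on the difference $t-s$, then $\boldsymbol X$ is stationary. Further, for any $t_i\in\mathcal T$, $\boldsymbol x_i\in(0,\infty)^d$, $1\le i\le n$, $$-\ln\mathbb P\{\boldsymbol X(t_i)\le\boldsymbol x_i,\,1\le i\le n\}=\sum_{(k,l)\in J}\frac1{x_{kl}}\,\mathbb P\Bigl\{\forall (i,j)\in J\setminus\{(k,l)\}:\ Y_i(t_j)-Y_k(t_l)-\tfrac12\mathrm{Var}\bigl(Y_i(t_j)-Y_k(t_l)\bigr)\le\ln(x_{ij}/x_{kl})\Bigr\},$$ where $J=\{(i,j):1\le i\le d,\ 1\le j\le n\}$, provided that $(\boldsymbol Y(t_1),\ldots,\boldsymbol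 Y(t_n))$ possesses a density.
   Context: Here $d,p,n$ are positive integers and $\mathcal T=\mathbb R^p$. Write $\boldsymbol x_j=(x_{1j},\ldots,x_{dj})$, so $x_{ij}$ is the $i$th component of $\boldsymbol x_j$; vector inequalities are componentwise. A process $\boldsymbol Z$ with continuous sample paths and non-negative components is a spectral process of the max-stable process $\boldsymbol X$ with index $\alpha=1$ if $\boldsymbol X$ has the same law as $\max_{i\ge1}\Gamma_i^{-1}\boldsymbol Z^{(i)}(t)$, $t\in\mathcal T$ (componentwise maximum), where $\Gamma_i=\sum_{k=1}^iE_k$ with $E_k$ independent unit exponential random variables, independent of the independent copies $\boldsymbol Z^{(i)}$, $i\ge1$, of $\boldsymbol Z$. $\boldsymbol X$ is stationary if $\boldsymbol X(\cdot-h)$ and $\boldsymbol X$ have the same law for every $h\in\mathcal T$. *)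

theory Defs
  imports "HOL-Probability.Probability"
begin

text \<open>
  The dimensions \<open>d\<close> and \<open>p\<close> are the cardinalities of the finite types \<open>'d\<close> and \<open>'p\<close>.
  A stochastic process is a family of random elements on a probability space, written with the
  index first: \<open>X t \<omega>\<close>.  Its law is taken on the product sigma-algebra, so equality of laws is
  equality of the finite-dimensional distributions.
\<close>

definition stochastic_process ::
  "'a measure \<Rightarrow> ('i \<Rightarrow> 'a \<Rightarrow> 'v::topological_space) \<Rightarrow> bool" where
  "stochastic_process M X \<longleftrightarrow> prob_space M \<and> (\<forall>t. X t \<in> borel_measurable M)"

definition process_law ::
  "'a measure \<Rightarrow> ('i \<Rightarrow> 'a \<Rightarrow> 'v::topological_space) \<Rightarrow> ('i \<Rightarrow> 'v) measure" where
  "process_law M X = distr M (\<Pi>\<^sub>M t\<in>UNIV. borel) (\<lambda>\<omega> t. X t \<omega>)"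

definition continuous_sample_paths ::
  "'a measure \<Rightarrow> ('i::topological_space \<Rightarrow> 'a \<Rightarrow> 'v::topological_space) \<Rightarrow> bool" where
  "continuous_sample_paths M X \<longleftrightarrow> (\<forall>\<omega>\<in>space M. continuous_on UNIV (\<lambda>t. X t \<omega>))"

definition stationary ::
  "'a measure \<Rightarrow> ('i::group_add \<Rightarrow> 'a \<Rightarrow> 'v::topological_space) \<Rightarrow> bool" where
  "stationary M X \<longleftrightarrow> (\<forall>h. process_law M (\<lambda>t. X (t - h)) = process_law M X)"

text \<open>Constants count as Gaussian (with variance zero).\<close>

definition gaussian_rv :: "'a measure \<Rightarrow> ('a \<Rightarrow> real) \<Rightarrow> bool" where
  "gaussian_rv M V \<longleftrightarrow> V \<in> borel_measurable M \<and>
     ((\<exists>\<mu> \<sigma>. 0 < \<sigma> \<and> distributed M lborel V (\<lambda>v. ennreal (normal_density \<mu> \<sigma> v))) \<or>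
      (\<exists>\<mu>. AE \<omega> in M. V \<omega> = \<mu>))"

definition gaussian_process ::
  "'a measure \<Rightarrow> ('i \<Rightarrow> 'a \<Rightarrow> real ^ 'd) \<Rightarrow> bool" where
  "gaussian_process M Y \<longleftrightarrow> stochastic_process M Y \<and>
     (\<forall>S a. finite S \<longrightarrow> gaussian_rv M (\<lambda>\<omega>. \<Sum>t\<in>S. \<Sum>i\<in>UNIV. a t i * Y t \<omega> $ i))"

definition centered :: "'a measure \<Rightarrow> ('i \<Rightarrow> 'a \<Rightarrow> real ^ 'd) \<Rightarrow> bool" where
  "centered M Y \<longleftrightarrow> (\<forall>t i. prob_space.expectation M (\<lambda>\<omega>. Y t \<omega> $ i) = 0)"

definition independent_copies ::
  "'q measure \<Rightarrow> (nat \<Rightarrow> 'i \<Rightarrow> 'q \<Rightarrow> 'v::topological_space) \<Rightarrow>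
    'b measure \<Rightarrow> ('i \<Rightarrow> 'b \<Rightarrow> 'v) \<Rightarrow> bool" where
  "independent_copies P Zs N Z \<longleftrightarrow>
     (\<forall>m. stochastic_process P (Zs m) \<and> process_law P (Zs m) = process_law N Z) \<and>
     prob_space.indep_vars P (\<lambda>_. \<Pi>\<^sub>M t\<in>UNIV. borel) (\<lambda>m \<omega> t. Zs m t \<omega>) UNIV"

definition independent_unit_exponentials :: "'q measure \<Rightarrow> (nat \<Rightarrow> 'q \<Rightarrow> real) \<Rightarrow> bool" where
  "independent_unit_exponentials P E \<longleftrightarrow>
     (\<forall>k. distributed P lborel (E k) (\<lambda>v. ennreal (exponential_density 1 v))) \<and>
     prob_space.indep_vars P (\<lambda>_. borel) E UNIV"

text \<open>
  The library's \<open>indep_var\<close> forces both random elements to have the same type of values.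
\<close>

definition independent_elements ::
  "'q measure \<Rightarrow> 'u measure \<Rightarrow> ('q \<Rightarrow> 'u) \<Rightarrow> 'v measure \<Rightarrow> ('q \<Rightarrow> 'v) \<Rightarrow> bool" where
  "independent_elements P S U T V \<longleftrightarrow>
     U \<in> measurable P S \<and> V \<in> measurable P T \<and>
     prob_space.indep_set P {U -` A \<inter> space P |A. A \<in> sets S} {V -` B \<inter> space P |B. B \<in> sets T}"

text \<open>
  Sequences are indexed from 0, so \<open>arrival E m\<close> is the sum of the first \<open>m + 1\<close> variables,
  i.e. the point that is usually called \<open>\<Gamma>\<close> with index \<open>m + 1\<close>.
\<close>

definition arrival :: "(nat \<Rightarrow> 'q \<Rightarrow> real) \<Rightarrow> nat \<Rightarrow> 'q \<Rightarrow> real" where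
  "arrival E m \<omega> = (\<Sum>k\<le>m. E k \<omega>)"

text \<open>
  \<open>Z\<close> (on \<open>N\<close>) is a spectral process of the max-stable process \<open>X\<close> (on \<open>M\<close>) with index 1, and
  \<open>P\<close>, \<open>E\<close>, \<open>Zs\<close> are the probability space, exponential variables and copies of \<open>Z\<close> that witness
  it.  The witnesses are arguments because the type of outcomes of \<open>P\<close> cannot be quantified
  existentially.  Laws are compared with values in the extended reals, where the
  supremum is always defined; as \<open>X\<close> is real-valued, this includes almost sure finiteness of
  the supremum.  A vector-valued process is identified with the scalar process indexed by
  pairs of a time and a component.
\<close>

definition spectral_process ::
  "'a measure \<Rightarrow> (real ^ 'p \<Rightarrow> 'a \<Rightarrow> real ^ 'd) \<Rightarrow>
   'b measure \<Rightarrow> (real ^ 'p \<Rightarrow> 'b \<Rightarrow> real ^ 'd) \<Rightarrow>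
   'q measure \<Rightarrow> (nat \<Rightarrow> 'q \<Rightarrow> real) \<Rightarrow> (nat \<Rightarrow> real ^ 'p \<Rightarrow> 'q \<Rightarrow> real ^ 'd) \<Rightarrow> bool" where
  "spectral_process M X N Z P E Zs \<longleftrightarrow>
     stochastic_process M X \<and>
     stochastic_process N Z \<and> continuous_sample_paths N Z \<and>
     (\<forall>\<omega>\<in>space N. \<forall>t i. 0 \<le> Z t \<omega> $ i) \<and>
     prob_space P \<and>
     independent_unit_exponentials P E \<and>
     independent_copies P Zs N Z \<and>
     independent_elements P
       (\<Pi>\<^sub>M k\<in>UNIV. borel) (\<lambda>\<omega> k. E k \<omega>)
       (\<Pi>\<^sub>M m\<in>UNIV. \<Pi>\<^sub>M t\<in>UNIV. borel) (\<lambda>\<omega> m t. Zs m t \<omega>) \<and>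
     process_law M (\<lambda>(t, i) \<omega>. ereal (X t \<omega> $ i)) =
     process_law P (\<lambda>(t, i) \<omega>. SUP m. ereal (inverse (arrival E m \<omega>) * Zs m t \<omega> $ i))"

definition brown_resnick_spectral ::
  "'b measure \<Rightarrow> (real ^ 'p \<Rightarrow> 'b \<Rightarrow> real ^ 'd) \<Rightarrow> real ^ 'p \<Rightarrow> 'b \<Rightarrow> real ^ 'd" where
  "brown_resnick_spectral N Y t \<omega> =
     (\<chi> i. exp (Y t \<omega> $ i - prob_space.variance N (\<lambda>\<omega>'. Y t \<omega>' $ i) / 2))"

definition brown_resnick ::
  "'a measure \<Rightarrow> (real ^ 'p \<Rightarrow> 'a \<Rightarrow> real ^ 'd) \<Rightarrow>
   'b measure \<Rightarrow> (real ^ 'p \<Rightarrow> 'b \<Rightarrow> real ^ 'd) \<Rightarrow>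
   'q measure \<Rightarrow> (nat \<Rightarrow> 'q \<Rightarrow> real) \<Rightarrow> (nat \<Rightarrow> real ^ 'p \<Rightarrow> 'q \<Rightarrow> real ^ 'd) \<Rightarrow> bool" where
  "brown_resnick M X N Y P E Zs \<longleftrightarrow>
     gaussian_process N Y \<and> centered N Y \<and> continuous_sample_paths N Y \<and>
     spectral_process M X N (brown_resnick_spectral N Y) P E Zs"

definition pseudo_variogram ::
  "'b measure \<Rightarrow> (real ^ 'p \<Rightarrow> 'b \<Rightarrow> real ^ 'd) \<Rightarrow>
   'd \<Rightarrow> 'd \<Rightarrow> real ^ 'p \<Rightarrow> real ^ 'p \<Rightarrow> real" where
  "pseudo_variogram N Y i j t s = prob_space.variance N (\<lambda>\<omega>. Y t \<omega> $ i - Y s \<omega> $ j)"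

end

theory Submission
  imports Defs
begin

text \<open>
  Restricted to finitely many thresholds, \<open>X\<close> stays below them iff no point \<open>(\<Gamma>, w)\<close> of the Poisson process
  of arrival times marked with i.i.d. copies of \<open>W = max (Z / x)\<close> satisfies \<open>\<Gamma> < w\<close>, which has
  probability \<open>exp (- E W)\<close>.  Weighting by \<open>exp (Y\<^sub>p - Var Y\<^sub>p / 2)\<close> shifts the Gaussian process by its
  covariance with \<open>Y\<^sub>p\<close> (Cameron-Martin), so that \<open>E W\<close> becomes the expectation of a function of the increments
  \<open>Y\<^sub>k - Y\<^sub>p - Var (Y\<^sub>k - Y\<^sub>p) / 2\<close>, whose law is determined by the variogram.  Splitting \<open>E W\<close> according
  to the index where the maximum is attained, and using a different \<open>p\<close> on each piece, gives the formula.
\<close>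

section \<open>Uniqueness of laws of processes\<close>

text \<open>The covariance of \<open>Y\<close> is not a function of the variogram: adding one
  independent centered Gaussian variable to all components changes the former but not the latter.
  This is why expectations have to be rewritten in terms of increments before two processes can be
  compared. No Poisson random measure is constructed. The void probability is studied as a function
  of a starting time \<open>s\<close>: conditioning on the first arrival moves the start from
  \<open>s\<close> to \<open>s + U\<close>, so that exp (- E (W - s)^+) is a fixed point of an
  integral recursion, and the probabilities for the first \<open>n\<close> points are squeezed onto
  it. Uniqueness of characteristic functions enters on the real line only; joint laws are reached
  one coordinate at a time, and likewise for distribution functions. The void probability gives the
  distribution function of \<open>X\<close> at positive thresholds. The other thresholds are covered
  by letting a threshold of a single margin tend to zero.\<close>

lemma iexp_add: "iexp (x + y) = iexp x * iexp y"
  by (simp add: distrib_left exp_add)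

section \<open>Characteristic functions under bounded weights\<close>

lemma (in finite_measure) integrable_weighted_iexp:
  fixes w :: "'a \<Rightarrow> real"
  assumes [measurable]: "w \<in> borel_measurable M" "V \<in> borel_measurable M"
    and "\<And>\<omega>. \<bar>w \<omega>\<bar> \<le> C"
  shows "integrable M (\<lambda>\<omega>. complex_of_real (w \<omega>) * iexp (V \<omega>))"
  by (rule integrable_const_bound[where B=C]) (use assms in \<open>auto simp: norm_mult\<close>)

text \<open>Dividing a bounded non-negative weight by its mass makes it a probability density, and
  the law of \<open>V\<close> under it is a distribution on the line to which Levy's uniqueness
  theorem applies.\<close>

lemma (in finite_measure) normalized_weight_distribution:
  fixes w V :: "'a \<Rightarrow> real"
  assumes [measurable]: "w \<in> borel_measurable M" "V \<in> borel_measurable M"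
    and bd: "\<And>\<omega>. 0 \<le> w \<omega>" "\<And>\<omega>. w \<omega> \<le> C"
    and c: "c = (LINT \<omega>|M. w \<omega>)" "0 < c"
  defines "D \<equiv> distr (density M (\<lambda>\<omega>. ennreal (w \<omega> / c))) borel V"
  shows "real_distribution D"
    and "char D s = (CLINT \<omega>|M. of_real (w \<omega>) * iexp (s * V \<omega>)) / of_real c"
    and "A \<in> sets borel \<Longrightarrow> (LINT x|D. indicator A x) = (LINT \<omega>|M. w \<omega> * indicator A (V \<omega>)) / c"
proof -
  have int: "integrable M w"
    using bd by (auto intro!: integrable_const_bound[where B=C])
  have "prob_space (density M (\<lambda>\<omega>. ennreal (w \<omega> / c)))"
  proof
    have "(\<integral>\<^sup>+\<omega>. ennreal (w \<omega> / c) \<partial>M) = ennreal (LINT \<omega>|M. w \<omega> / c)"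
      using int bd c(2) by (intro nn_integral_eq_integral) auto
    also have "\<dots> = 1" using c(2) by (simp add: c(1)[symmetric])
    finally show "emeasure (density M (\<lambda>\<omega>. ennreal (w \<omega> / c))) (space (density M (\<lambda>\<omega>. ennreal (w \<omega> / c)))) = 1"
      by (simp add: emeasure_density cong: nn_integral_cong)
  qed
  then show "real_distribution D" unfolding D_def
    by (intro prob_space.real_distribution_distr) auto
  have "char D s = (CLINT \<omega>|M. (w \<omega> / c) *\<^sub>R iexp (s * V \<omega>))"
    unfolding D_def char_def using bd c(2)
    by (subst integral_distr) (auto simp: integral_density)
  also have "\<dots> = (CLINT \<omega>|M. of_real (w \<omega>) * iexp (s * V \<omega>) / of_real c)"
    by (intro Bochner_Integration.integral_cong) (auto simp: scaleR_conv_of_real)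
  finally show "char D s = (CLINT \<omega>|M. of_real (w \<omega>) * iexp (s * V \<omega>)) / of_real c"
    by simp
  assume [measurable]: "A \<in> sets borel"
  have "(LINT x|D. indicator A x) = (LINT \<omega>|M. (w \<omega> / c) *\<^sub>R (indicator A (V \<omega>) :: real))"
    unfolding D_def using bd c(2) by (subst integral_distr) (auto simp: integral_density)
  then show "(LINT x|D. indicator A x) = (LINT \<omega>|M. w \<omega> * indicator A (V \<omega>)) / c"
    by (simp del: integral_indicator)
qed

text \<open>Taking \<open>s = 0\<close> in the hypothesis shows that both weights have the same
  mass, so one normalization serves both sides. If that mass vanishes there is nothing to normalize,
  but then both integrals lie between 0 and the mass.\<close>

lemma weighted_char_unique:
  fixes V1 w1 :: "'a \<Rightarrow> real" and V2 w2 :: "'b \<Rightarrow> real"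
  assumes "finite_measure M1" "finite_measure M2"
    and meas1: "w1 \<in> borel_measurable M1" "V1 \<in> borel_measurable M1"
    and meas2: "w2 \<in> borel_measurable M2" "V2 \<in> borel_measurable M2"
    and bd1: "\<And>\<omega>. 0 \<le> w1 \<omega>" "\<And>\<omega>. w1 \<omega> \<le> C" and bd2: "\<And>\<omega>. 0 \<le> w2 \<omega>" "\<And>\<omega>. w2 \<omega> \<le> C"
    and eq: "\<And>s. (CLINT \<omega>|M1. of_real (w1 \<omega>) * iexp (s * V1 \<omega>)) =
                (CLINT \<omega>|M2. of_real (w2 \<omega>) * iexp (s * V2 \<omega>))"
    and A: "A \<in> sets borel"
  shows "(LINT \<omega>|M1. w1 \<omega> * indicator A (V1 \<omega>)) = (LINT \<omega>|M2. w2 \<omega> * indicator A (V2 \<omega>))"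
proof -
  interpret M1: finite_measure M1 by fact
  interpret M2: finite_measure M2 by fact
  note [measurable] = meas1 meas2 A
  define c where "c = (LINT \<omega>|M1. w1 \<omega>)"
  have c2: "c = (LINT \<omega>|M2. w2 \<omega>)"
    using eq[of 0] by (simp add: c_def)
  have int1: "integrable M1 w1" "integrable M1 (\<lambda>\<omega>. w1 \<omega> * indicator A (V1 \<omega>))"
    using bd1 order_trans[OF bd1]
    by (auto intro!: M1.integrable_const_bound[where B=C] simp: abs_mult indicator_def)
  have int2: "integrable M2 w2" "integrable M2 (\<lambda>\<omega>. w2 \<omega> * indicator A (V2 \<omega>))"
    using bd2 order_trans[OF bd2]
    by (auto intro!: M2.integrable_const_bound[where B=C] simp: abs_mult indicator_def)
  show ?thesis
  proof (cases "c = 0")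
    case True
    have "(LINT \<omega>|M1. w1 \<omega> * indicator A (V1 \<omega>)) \<le> c"
      unfolding c_def by (rule integral_mono) (use int1 bd1 in \<open>auto simp: indicator_def\<close>)
    moreover have "(LINT \<omega>|M2. w2 \<omega> * indicator A (V2 \<omega>)) \<le> c"
      unfolding c2 by (rule integral_mono) (use int2 bd2 in \<open>auto simp: indicator_def\<close>)
    moreover have "0 \<le> (LINT \<omega>|M1. w1 \<omega> * indicator A (V1 \<omega>))"
      "0 \<le> (LINT \<omega>|M2. w2 \<omega> * indicator A (V2 \<omega>))"
      using bd1 bd2 by (auto intro!: integral_nonneg_AE)
    ultimately show ?thesis using True by linarith
  next
    case False
    have "0 \<le> c" unfolding c_def using bd1 by (auto intro!: integral_nonneg_AE)
    with False have c: "0 < c" by simp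
    note D1 = M1.normalized_weight_distribution[OF meas1 bd1 c_def c]
    note D2 = M2.normalized_weight_distribution[OF meas2 bd2 c2 c]
    have "distr (density M1 (\<lambda>\<omega>. ennreal (w1 \<omega> / c))) borel V1 =
        distr (density M2 (\<lambda>\<omega>. ennreal (w2 \<omega> / c))) borel V2"
      by (intro Levy_uniqueness D1(1) D2(1) ext) (simp only: D1(2) D2(2) eq)
    then have "(LINT \<omega>|M1. w1 \<omega> * indicator A (V1 \<omega>)) / c = (LINT \<omega>|M2. w2 \<omega> * indicator A (V2 \<omega>)) / c"
      unfolding D1(3)[OF A, symmetric] D2(3)[OF A, symmetric] by simp
    then show ?thesis using c by (simp del: integral_indicator)
  qed
qed

text \<open>Lists may repeat an index, so a term is added by consing, with no side condition on
  whether the index already occurs, and identities follow by list induction.\<close>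

definition lincomb :: "('k \<Rightarrow> 'a \<Rightarrow> real) \<Rightarrow> ('k \<times> real) list \<Rightarrow> 'a \<Rightarrow> real" where
  "lincomb U l \<omega> = (\<Sum>(k, a)\<leftarrow>l. a * U k \<omega>)"

lemma lincomb_Nil [simp]: "lincomb U [] \<omega> = 0"
  and lincomb_Cons [simp]: "lincomb U ((k, a) # l) \<omega> = a * U k \<omega> + lincomb U l \<omega>"
  by (auto simp: lincomb_def)

lemma lincomb_uminus: "lincomb U (map (\<lambda>(k, a). (k, - a)) l) \<omega> = - lincomb U l \<omega>"
  by (induction l) auto

lemma measurable_lincomb [measurable]:
  assumes "\<And>k. U k \<in> borel_measurable M"
  shows "lincomb U l \<in> borel_measurable M"
proof (induction l)
  case Nil
  then show ?case by (simp add: lincomb_def[abs_def])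
next
  case (Cons p l)
  obtain k a where p: "p = (k, a)" by force
  have [measurable]: "lincomb U l \<in> borel_measurable M" "U k \<in> borel_measurable M"
    using Cons assms by auto
  show ?case unfolding p lincomb_Cons[abs_def] by simp
qed

text \<open>Written with exponentials, the trigonometric weight only moves the phase
  \<open>V\<close> by 0, \<open>\<theta>\<close> or \<open>- \<theta>\<close>. When \<open>V\<close>
  and \<open>\<theta>\<close> are linear combinations, all three phases are again linear
  combinations, to which an induction hypothesis applies.\<close>

lemma (in finite_measure) trigonometric_weight_char:
  fixes B V \<theta> :: "'a \<Rightarrow> real" and c d :: real
  assumes [measurable]: "B \<in> borel_measurable M" "V \<in> borel_measurable M" "\<theta> \<in> borel_measurable M"
    and "\<And>\<omega>. \<bar>B \<omega>\<bar> \<le> C"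
  shows "(CLINT \<omega>|M. of_real (B \<omega> * (1 + c * cos (\<theta> \<omega>) + d * sin (\<theta> \<omega>))) * iexp (V \<omega>)) =
    (CLINT \<omega>|M. of_real (B \<omega>) * iexp (V \<omega>)) +
    ((c - d * \<i>) / 2) * (CLINT \<omega>|M. of_real (B \<omega>) * iexp (V \<omega> + \<theta> \<omega>)) +
    ((c + d * \<i>) / 2) * (CLINT \<omega>|M. of_real (B \<omega>) * iexp (V \<omega> + - \<theta> \<omega>))"
proof -
  have trig: "of_real (b * (1 + c * cos t + d * sin t)) * iexp v =
      of_real b * iexp v + ((c - d * \<i>) / 2) * (of_real b * iexp (v + t)) +
      ((c + d * \<i>) / 2) * (of_real b * iexp (v + - t))" for b t v :: real
  proof -
    define e f where "e = iexp t" and "f = iexp (- t)"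
    have 1: "of_real (cos t) = (e + f) / 2" "of_real (sin t) = (- \<i>) * (e - f) / 2"
      by (simp_all add: e_def f_def cos_of_real[symmetric] sin_of_real[symmetric] cos_exp_eq sin_exp_eq
          del: cos_of_real sin_of_real)
    have "b * (1 + x * ((e + f) / 2) + y * ((- \<i>) * (e - f) / 2)) * a =
        b * a + ((x - y * \<i>) / 2) * (b * (a * e)) + ((x + y * \<i>) / 2) * (b * (a * f))"
      for a b x y :: complex
      by (simp add: field_simps)
    from this[of "of_real b" "of_real c" "of_real d" "iexp v", folded 1] show ?thesis
      unfolding iexp_add e_def f_def by (simp only: of_real_add of_real_mult of_real_1)
  qed
  have int: "integrable M (\<lambda>\<omega>. of_real (B \<omega>) * iexp (V \<omega>))"
    "integrable M (\<lambda>\<omega>. of_real (B \<omega>) * iexp (V \<omega> + \<theta> \<omega>))"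
    "integrable M (\<lambda>\<omega>. of_real (B \<omega>) * iexp (V \<omega> + - \<theta> \<omega>))"
    using assms(4) by (auto intro!: integrable_weighted_iexp simp del: of_real_add of_real_diff of_real_minus)
  show ?thesis
    unfolding trig
    by (simp only: int Bochner_Integration.integral_add Bochner_Integration.integrable_add
        integrable_mult_right integral_mult_right_zero)
qed

text \<open>The way back: the integrals against the weights with \<open>(c, d)\<close> equal to
  (0,0), (1,0) and (0,1) determine those against \<open>cos \<theta>\<close> and
  \<open>sin \<theta>\<close>, and these are the real and imaginary part of the complex
  integral.\<close>

lemma (in finite_measure) weighted_iexp_cos_sin:
  fixes C \<theta> :: "'a \<Rightarrow> real"
  assumes [measurable]: "C \<in> borel_measurable M" "\<theta> \<in> borel_measurable M"
    and C: "\<And>\<omega>. \<bar>C \<omega>\<bar> \<le> 1"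
  shows "(CLINT \<omega>|M. of_real (C \<omega>) * iexp (\<theta> \<omega>)) =
      of_real (LINT \<omega>|M. C \<omega> * cos (\<theta> \<omega>)) + \<i> * of_real (LINT \<omega>|M. C \<omega> * sin (\<theta> \<omega>))"
    and "(LINT \<omega>|M. C \<omega> * (1 + c * cos (\<theta> \<omega>) + d * sin (\<theta> \<omega>))) =
      (LINT \<omega>|M. C \<omega>) + c * (LINT \<omega>|M. C \<omega> * cos (\<theta> \<omega>)) + d * (LINT \<omega>|M. C \<omega> * sin (\<theta> \<omega>))"
proof -
  have int: "integrable M C" "integrable M (\<lambda>\<omega>. C \<omega> * cos (\<theta> \<omega>))" "integrable M (\<lambda>\<omega>. C \<omega> * sin (\<theta> \<omega>))"
    using C by (auto intro!: integrable_const_bound[where B=1] simp: abs_mult mult_le_one)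
  have cs: "of_real a * iexp t = complex_of_real (a * cos t) + \<i> * complex_of_real (a * sin t)" for a t :: real
    by (simp add: exp_Euler cos_of_real sin_of_real algebra_simps)
  show "(CLINT \<omega>|M. of_real (C \<omega>) * iexp (\<theta> \<omega>)) =
      of_real (LINT \<omega>|M. C \<omega> * cos (\<theta> \<omega>)) + \<i> * of_real (LINT \<omega>|M. C \<omega> * sin (\<theta> \<omega>))"
    unfolding cs by (subst Bochner_Integration.integral_add)
      (simp_all only: integral_complex_of_real integral_mult_right_zero integrable_of_real int integrable_mult_right)
  have "(LINT \<omega>|M. C \<omega> * (1 + c * cos (\<theta> \<omega>) + d * sin (\<theta> \<omega>))) =
     (LINT \<omega>|M. C \<omega> + c * (C \<omega> * cos (\<theta> \<omega>)) + d * (C \<omega> * sin (\<theta> \<omega>)))"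
    by (intro Bochner_Integration.integral_cong) (auto simp: algebra_simps)
  then show "(LINT \<omega>|M. C \<omega> * (1 + c * cos (\<theta> \<omega>) + d * sin (\<theta> \<omega>))) =
      (LINT \<omega>|M. C \<omega>) + c * (LINT \<omega>|M. C \<omega> * cos (\<theta> \<omega>)) + d * (LINT \<omega>|M. C \<omega> * sin (\<theta> \<omega>))"
    using int by simp
qed

text \<open>
  The coordinates are passed one at a time from the exponential to the indicators.  One-dimensional
  uniqueness needs non-negative weights, so \<open>iexp \<theta>\<close> is recovered from the weights \<open>1\<close>, \<open>1 + cos \<theta>\<close>
  and \<open>1 + sin \<theta>\<close>.
\<close>

lemma weighted_lincomb_char_eq:
  fixes U1 :: "'k \<Rightarrow> 'a \<Rightarrow> real" and U2 :: "'k \<Rightarrow> 'b \<Rightarrow> real"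
  assumes "prob_space M1" "prob_space M2"
    and U1: "\<And>k. U1 k \<in> borel_measurable M1" and U2: "\<And>k. U2 k \<in> borel_measurable M2"
    and eq: "\<And>l. (CLINT \<omega>|M1. iexp (lincomb U1 l \<omega>)) = (CLINT \<omega>|M2. iexp (lincomb U2 l \<omega>))"
    and "finite S" and A: "\<And>k. A k \<in> sets borel"
  shows "(CLINT \<omega>|M1. of_real (\<Prod>k\<in>S. indicator (A k) (U1 k \<omega>)) * iexp (lincomb U1 l \<omega>)) =
         (CLINT \<omega>|M2. of_real (\<Prod>k\<in>S. indicator (A k) (U2 k \<omega>)) * iexp (lincomb U2 l \<omega>))"
  using \<open>finite S\<close>
proof (induction S arbitrary: l)
  case empty
  then show ?case using eq by simp
next
  case (insert k S)
  interpret M1: prob_space M1 by fact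
  interpret M2: prob_space M2 by fact
  note [measurable] = U1 U2 A
  define B1 where "B1 \<omega> = (\<Prod>k\<in>S. indicator (A k) (U1 k \<omega>) :: real)" for \<omega>
  define B2 where "B2 \<omega> = (\<Prod>k\<in>S. indicator (A k) (U2 k \<omega>) :: real)" for \<omega>
  have [measurable]: "B1 \<in> borel_measurable M1" "B2 \<in> borel_measurable M2"
    unfolding B1_def B2_def by measurable
  have B1: "0 \<le> B1 \<omega>" "B1 \<omega> \<le> 1" for \<omega>
    unfolding B1_def by (auto intro!: prod_nonneg prod_le_1 simp: indicator_def)
  have B2: "0 \<le> B2 \<omega>" "B2 \<omega> \<le> 1" for \<omega>
    unfolding B2_def by (auto intro!: prod_nonneg prod_le_1 simp: indicator_def)
  have IH: "(CLINT \<omega>|M1. of_real (B1 \<omega>) * iexp (lincomb U1 l \<omega>)) =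
      (CLINT \<omega>|M2. of_real (B2 \<omega>) * iexp (lincomb U2 l \<omega>))" for l
    using insert.IH unfolding B1_def B2_def .
  let ?m = "map (\<lambda>(k, a). (k, - a :: real)) l"
  let ?w = "\<lambda>c d \<theta>. 1 + c * cos \<theta> + d * sin \<theta> :: real"
  let ?i1 = "\<lambda>\<omega>. indicator (A k) (U1 k \<omega>) :: real" and ?i2 = "\<lambda>\<omega>. indicator (A k) (U2 k \<omega>) :: real"
  have eqw: "(LINT \<omega>|M1. (B1 \<omega> * ?w c d (lincomb U1 l \<omega>)) * ?i1 \<omega>) =
     (LINT \<omega>|M2. (B2 \<omega> * ?w c d (lincomb U2 l \<omega>)) * ?i2 \<omega>)"
    if cd: "c = 0 \<and> d = 0 \<or> c = 1 \<and> d = 0 \<or> c = 0 \<and> d = 1" for c d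
  proof (rule weighted_char_unique[where C=2])
    have b: "0 \<le> ?w c d \<theta>" "?w c d \<theta> \<le> 2" for \<theta>
      using cd cos_ge_minus_one[of \<theta>] sin_ge_minus_one[of \<theta>] cos_le_one[of \<theta>] sin_le_one[of \<theta>]
      by (linarith | (elim disjE conjE; simp))+
    show "0 \<le> B1 \<omega> * ?w c d (lincomb U1 l \<omega>)" for \<omega>
      by (intro mult_nonneg_nonneg B1 b)
    show "0 \<le> B2 \<omega> * ?w c d (lincomb U2 l \<omega>)" for \<omega>
      by (intro mult_nonneg_nonneg B2 b)
    show "B1 \<omega> * ?w c d (lincomb U1 l \<omega>) \<le> 2" for \<omega>
      using mult_mono[OF B1(2) b(2) zero_le_one b(1), of \<omega> "lincomb U1 l \<omega>"] by simp
    show "B2 \<omega> * ?w c d (lincomb U2 l \<omega>) \<le> 2" for \<omega>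
      using mult_mono[OF B2(2) b(2) zero_le_one b(1), of \<omega> "lincomb U2 l \<omega>"] by simp
    fix s
    \<comment> \<open>The term \<open>s * U1 k\<close> joins the linear combination as a new list
      entry; this is why the induction hypothesis has to hold for every \<open>l\<close>.\<close>
    have IH': "(CLINT \<omega>|M1. of_real (B1 \<omega>) * iexp (s * U1 k \<omega>)) = (CLINT \<omega>|M2. of_real (B2 \<omega>) * iexp (s * U2 k \<omega>))"
      "(CLINT \<omega>|M1. of_real (B1 \<omega>) * iexp (s * U1 k \<omega> + lincomb U1 l \<omega>)) =
       (CLINT \<omega>|M2. of_real (B2 \<omega>) * iexp (s * U2 k \<omega> + lincomb U2 l \<omega>))"
      "(CLINT \<omega>|M1. of_real (B1 \<omega>) * iexp (s * U1 k \<omega> + - lincomb U1 l \<omega>)) =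
       (CLINT \<omega>|M2. of_real (B2 \<omega>) * iexp (s * U2 k \<omega> + - lincomb U2 l \<omega>))"
      using IH[of "[(k, s)]"] IH[of "(k, s) # l"] IH[of "(k, s) # ?m"]
      by (simp_all only: lincomb_Cons lincomb_Nil lincomb_uminus add_0_right)
    have "(CLINT \<omega>|M1. of_real (B1 \<omega> * ?w c d (lincomb U1 l \<omega>)) * iexp (s * U1 k \<omega>)) =
       (CLINT \<omega>|M1. of_real (B1 \<omega>) * iexp (s * U1 k \<omega>)) +
       ((c - d * \<i>) / 2) * (CLINT \<omega>|M1. of_real (B1 \<omega>) * iexp (s * U1 k \<omega> + lincomb U1 l \<omega>)) +
       ((c + d * \<i>) / 2) * (CLINT \<omega>|M1. of_real (B1 \<omega>) * iexp (s * U1 k \<omega> + - lincomb U1 l \<omega>))"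
      by (rule M1.trigonometric_weight_char[where C=1]) (use B1 in auto)
    also have "\<dots> = (CLINT \<omega>|M2. of_real (B2 \<omega> * ?w c d (lincomb U2 l \<omega>)) * iexp (s * U2 k \<omega>))"
      unfolding IH' by (rule M2.trigonometric_weight_char[where C=1, symmetric]) (use B2 in auto)
    finally show "(CLINT \<omega>|M1. of_real (B1 \<omega> * ?w c d (lincomb U1 l \<omega>)) * iexp (s * U1 k \<omega>)) =
      (CLINT \<omega>|M2. of_real (B2 \<omega> * ?w c d (lincomb U2 l \<omega>)) * iexp (s * U2 k \<omega>))" .
  qed (use M1.finite_measure_axioms M2.finite_measure_axioms A in auto)
  define C1 where "C1 \<omega> = B1 \<omega> * ?i1 \<omega>" for \<omega>
  define C2 where "C2 \<omega> = B2 \<omega> * ?i2 \<omega>" for \<omega>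
  have [measurable]: "C1 \<in> borel_measurable M1" "C2 \<in> borel_measurable M2"
    unfolding C1_def C2_def by measurable
  have C1: "\<bar>C1 \<omega>\<bar> \<le> 1" for \<omega> using B1[of \<omega>] by (auto simp: C1_def indicator_def)
  have C2: "\<bar>C2 \<omega>\<bar> \<le> 1" for \<omega> using B2[of \<omega>] by (auto simp: C2_def indicator_def)
  have cs1: "(CLINT \<omega>|M1. of_real (C1 \<omega>) * iexp (lincomb U1 l \<omega>)) =
      of_real (LINT \<omega>|M1. C1 \<omega> * cos (lincomb U1 l \<omega>)) + \<i> * of_real (LINT \<omega>|M1. C1 \<omega> * sin (lincomb U1 l \<omega>))"
    and w1: "\<And>c d. (LINT \<omega>|M1. C1 \<omega> * ?w c d (lincomb U1 l \<omega>)) =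
      (LINT \<omega>|M1. C1 \<omega>) + c * (LINT \<omega>|M1. C1 \<omega> * cos (lincomb U1 l \<omega>)) + d * (LINT \<omega>|M1. C1 \<omega> * sin (lincomb U1 l \<omega>))"
    by (rule M1.weighted_iexp_cos_sin; use C1 in simp)+
  have cs2: "(CLINT \<omega>|M2. of_real (C2 \<omega>) * iexp (lincomb U2 l \<omega>)) =
      of_real (LINT \<omega>|M2. C2 \<omega> * cos (lincomb U2 l \<omega>)) + \<i> * of_real (LINT \<omega>|M2. C2 \<omega> * sin (lincomb U2 l \<omega>))"
    and w2: "\<And>c d. (LINT \<omega>|M2. C2 \<omega> * ?w c d (lincomb U2 l \<omega>)) =
      (LINT \<omega>|M2. C2 \<omega>) + c * (LINT \<omega>|M2. C2 \<omega> * cos (lincomb U2 l \<omega>)) + d * (LINT \<omega>|M2. C2 \<omega> * sin (lincomb U2 l \<omega>))"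
    by (rule M2.weighted_iexp_cos_sin; use C2 in simp)+
  have eqC: "(LINT \<omega>|M1. C1 \<omega> * ?w c d (lincomb U1 l \<omega>)) = (LINT \<omega>|M2. C2 \<omega> * ?w c d (lincomb U2 l \<omega>))"
    if cd: "c = 0 \<and> d = 0 \<or> c = 1 \<and> d = 0 \<or> c = 0 \<and> d = 1" for c d
    using eqw[OF cd] by (simp only: C1_def C2_def mult_ac)
  have "(LINT \<omega>|M1. C1 \<omega> * cos (lincomb U1 l \<omega>)) = (LINT \<omega>|M2. C2 \<omega> * cos (lincomb U2 l \<omega>))"
    "(LINT \<omega>|M1. C1 \<omega> * sin (lincomb U1 l \<omega>)) = (LINT \<omega>|M2. C2 \<omega> * sin (lincomb U2 l \<omega>))"
    using eqC[of 0 0] eqC[of 1 0] eqC[of 0 1] unfolding w1 w2 by simp_all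
  then have "(CLINT \<omega>|M1. of_real (C1 \<omega>) * iexp (lincomb U1 l \<omega>)) =
      (CLINT \<omega>|M2. of_real (C2 \<omega>) * iexp (lincomb U2 l \<omega>))"
    unfolding cs1 cs2 by simp
  then show ?case
    by (simp only: C1_def C2_def B1_def B2_def prod.insert[OF insert.hyps] mult_ac)
qed

section \<open>Laws determined by rectangles, characteristic functions and distribution
  functions\<close>

lemma process_law_eqI:
  fixes U1 :: "'k \<Rightarrow> 'a \<Rightarrow> 'v::topological_space" and U2 :: "'k \<Rightarrow> 'b \<Rightarrow> 'v"
  assumes "prob_space M1" "prob_space M2"
    and U1: "\<And>k. U1 k \<in> borel_measurable M1" and U2: "\<And>k. U2 k \<in> borel_measurable M2"
    and eq: "\<And>S A. finite S \<Longrightarrow> (\<And>k. A k \<in> sets borel) \<Longrightarrow>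
      measure M1 {\<omega>\<in>space M1. \<forall>k\<in>S. U1 k \<omega> \<in> A k} = measure M2 {\<omega>\<in>space M2. \<forall>k\<in>S. U2 k \<omega> \<in> A k}"
  shows "process_law M1 U1 = process_law M2 U2"
proof -
  interpret M1: prob_space M1 by fact
  interpret M2: prob_space M2 by fact
  have mU1: "(\<lambda>\<omega> t. U1 t \<omega>) \<in> measurable M1 (\<Pi>\<^sub>M t\<in>UNIV. borel)"
    using U1 by (intro measurable_PiM_single') auto
  have mU2: "(\<lambda>\<omega> t. U2 t \<omega>) \<in> measurable M2 (\<Pi>\<^sub>M t\<in>UNIV. borel)"
    using U2 by (intro measurable_PiM_single') auto
  show ?thesis
    unfolding process_law_def
  proof (rule measure_eqI_PiM_infinite)
    show "finite_measure (distr M1 (\<Pi>\<^sub>M t\<in>UNIV. borel) (\<lambda>\<omega> t. U1 t \<omega>))"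
      by (intro M1.finite_measure_distr mU1)
    fix A :: "'k \<Rightarrow> 'v set" and J :: "'k set"
    assume J: "finite J" and A: "\<And>i. i \<in> J \<Longrightarrow> A i \<in> sets borel"
    \<comment> \<open>The rectangle is measurable only along \<open>J\<close>, whereas the
      hypothesis asks for Borel sets at all indices; the sides outside \<open>J\<close> do not
      affect the event.\<close>
    define A' where "A' k = (if k \<in> J then A k else {})" for k
    have "A' k \<in> sets borel" for k using A by (auto simp: A'_def)
    note eq' = eq[OF J, of A', OF this]
    have m: "prod_emb UNIV (\<lambda>_. borel) J (Pi\<^sub>E J A) \<in> sets (\<Pi>\<^sub>M t\<in>UNIV. borel)"
      using J A by (intro sets_PiM_I) auto
    have 1: "(\<lambda>\<omega> t. U1 t \<omega>) -` prod_emb UNIV (\<lambda>_. borel) J (Pi\<^sub>E J A) \<inter> space M1 = {\<omega>\<in>space M1. \<forall>k\<in>J. U1 k \<omega> \<in> A' k}"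
      by (auto simp: prod_emb_def A'_def PiE_iff)
    have 2: "(\<lambda>\<omega> t. U2 t \<omega>) -` prod_emb UNIV (\<lambda>_. borel) J (Pi\<^sub>E J A) \<inter> space M2 = {\<omega>\<in>space M2. \<forall>k\<in>J. U2 k \<omega> \<in> A' k}"
      by (auto simp: prod_emb_def A'_def PiE_iff)
    show "emeasure (distr M1 (\<Pi>\<^sub>M t\<in>UNIV. borel) (\<lambda>\<omega> t. U1 t \<omega>)) (prod_emb UNIV (\<lambda>_. borel) J (Pi\<^sub>E J A)) =
      emeasure (distr M2 (\<Pi>\<^sub>M t\<in>UNIV. borel) (\<lambda>\<omega> t. U2 t \<omega>)) (prod_emb UNIV (\<lambda>_. borel) J (Pi\<^sub>E J A))"
      using eq' by (simp add: emeasure_distr[OF mU1 m] emeasure_distr[OF mU2 m] 1 2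
          M1.emeasure_eq_measure M2.emeasure_eq_measure)
  qed simp_all
qed

text \<open>A form of the Cramer-Wold device. With all coordinates moved into indicators and the
  empty linear combination left over, the exponential is 1 and the integral is a rectangle
  probability.\<close>

lemma process_law_eqI_char:
  fixes U1 :: "'k \<Rightarrow> 'a \<Rightarrow> real" and U2 :: "'k \<Rightarrow> 'b \<Rightarrow> real"
  assumes "prob_space M1" "prob_space M2"
    and U1: "\<And>k. U1 k \<in> borel_measurable M1" and U2: "\<And>k. U2 k \<in> borel_measurable M2"
    and eq: "\<And>l. (CLINT \<omega>|M1. iexp (lincomb U1 l \<omega>)) = (CLINT \<omega>|M2. iexp (lincomb U2 l \<omega>))"
  shows "process_law M1 U1 = process_law M2 U2"
proof (rule process_law_eqI[OF assms(1-4)])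
  fix S :: "'k set" and A :: "'k \<Rightarrow> real set"
  assume S: "finite S" and A: "\<And>k. A k \<in> sets borel"
  note [measurable] = U1 U2 A
  have ind: "(\<Prod>k\<in>S. indicator (A k) (f k)) = (if \<forall>k\<in>S. f k \<in> A k then 1 else (0::real))" for f
  proof (cases "\<forall>k\<in>S. f k \<in> A k")
    case False
    then have "\<exists>k\<in>S. indicator (A k) (f k) = (0::real)" by (auto simp: indicator_def)
    then show ?thesis using S False by (auto simp: prod_zero_iff)
  qed simp
  have "(LINT \<omega>|M1. (\<Prod>k\<in>S. indicator (A k) (U1 k \<omega>))) = (LINT \<omega>|M2. (\<Prod>k\<in>S. indicator (A k) (U2 k \<omega>) :: real))"
    using weighted_lincomb_char_eq[OF assms(1-5) S, of A "[]"] A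
    by (simp del: of_real_prod)
  moreover have "(LINT \<omega>|M1. (\<Prod>k\<in>S. indicator (A k) (U1 k \<omega>))) = measure M1 {\<omega>\<in>space M1. \<forall>k\<in>S. U1 k \<omega> \<in> A k}"
    using S unfolding ind
    by (subst Bochner_Integration.integral_cong[OF refl, where g="indicator {\<omega>\<in>space M1. \<forall>k\<in>S. U1 k \<omega> \<in> A k}"]) auto
  moreover have "(LINT \<omega>|M2. (\<Prod>k\<in>S. indicator (A k) (U2 k \<omega>))) = measure M2 {\<omega>\<in>space M2. \<forall>k\<in>S. U2 k \<omega> \<in> A k}"
    using S unfolding ind
    by (subst Bochner_Integration.integral_cong[OF refl, where g="indicator {\<omega>\<in>space M2. \<forall>k\<in>S. U2 k \<omega> \<in> A k}"]) auto
  ultimately show "measure M1 {\<omega>\<in>space M1. \<forall>k\<in>S. U1 k \<omega> \<in> A k} = measure M2 {\<omega>\<in>space M2. \<forall>k\<in>S. U2 k \<omega> \<in> A k}"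
    by simp
qed

lemma emeasure_distr_density_indicator:
  assumes [measurable]: "R \<in> sets M" "V \<in> borel_measurable M" "B \<in> sets borel"
  shows "emeasure (distr (density M (indicator R)) borel V) B = emeasure M {\<omega>\<in>R. V \<omega> \<in> B}"
proof -
  have "emeasure (distr (density M (indicator R)) borel V) B = (\<integral>\<^sup>+\<omega>. indicator {\<omega>\<in>R. V \<omega> \<in> B} \<omega> \<partial>M)"
    using sets.sets_into_space[OF \<open>R \<in> sets M\<close>]
    by (auto simp: emeasure_distr emeasure_density indicator_def intro!: nn_integral_cong)
  also have "\<dots> = emeasure M {\<omega>\<in>R. V \<omega> \<in> B}"
    by (rule nn_integral_indicator) measurable
  finally show ?thesis .
qed

text \<open>Half-lines are exchanged for Borel sets one coordinate at a time: with the other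
  constraints frozen in an event \<open>R\<close>, the set function that sends \<open>B\<close> to
  the measure of \<open>R\<close> intersected with \<open>U k \<in> B\<close> is a finite measure on
  the line, determined by its distribution function. It need not be a probability.\<close>

lemma process_law_eqI_cdf:
  fixes U1 :: "'k \<Rightarrow> 'a \<Rightarrow> real" and U2 :: "'k \<Rightarrow> 'b \<Rightarrow> real"
  assumes "prob_space M1" "prob_space M2"
    and U1: "\<And>k. U1 k \<in> borel_measurable M1" and U2: "\<And>k. U2 k \<in> borel_measurable M2"
    and eq: "\<And>T. finite T \<Longrightarrow>
      measure M1 {\<omega>\<in>space M1. \<forall>(k, b)\<in>T. U1 k \<omega> \<le> b} = measure M2 {\<omega>\<in>space M2. \<forall>(k, b)\<in>T. U2 k \<omega> \<le> b}"
  shows "process_law M1 U1 = process_law M2 U2"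
proof (rule process_law_eqI[OF assms(1-4)])
  interpret M1: prob_space M1 by fact
  interpret M2: prob_space M2 by fact
  fix S :: "'k set" and A :: "'k \<Rightarrow> real set"
  assume S: "finite S" and A: "\<And>k. A k \<in> sets borel"
  note [measurable] = U1 U2 A
  \<comment> \<open>The mixed form carries the induction: testing coordinate \<open>k\<close> on a
    half-line adds a pair to \<open>T\<close>, so \<open>T\<close> must vary. As a set of pairs,
    \<open>T\<close> may hold several bounds for the same index.\<close>
  have gen: "measure M1 {\<omega>\<in>space M1. (\<forall>k\<in>S. U1 k \<omega> \<in> A k) \<and> (\<forall>(k, b)\<in>T. U1 k \<omega> \<le> b)} =
    measure M2 {\<omega>\<in>space M2. (\<forall>k\<in>S. U2 k \<omega> \<in> A k) \<and> (\<forall>(k, b)\<in>T. U2 k \<omega> \<le> b)}" if "finite T" for T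
    using S that
  proof (induction S arbitrary: T)
    case empty
    then show ?case using eq by simp
  next
    case (insert k S)
    define R1 where "R1 = {\<omega>\<in>space M1. (\<forall>k\<in>S. U1 k \<omega> \<in> A k) \<and> (\<forall>(k, b)\<in>T. U1 k \<omega> \<le> b)}"
    define R2 where "R2 = {\<omega>\<in>space M2. (\<forall>k\<in>S. U2 k \<omega> \<in> A k) \<and> (\<forall>(k, b)\<in>T. U2 k \<omega> \<le> b)}"
    have [measurable]: "R1 \<in> sets M1" "R2 \<in> sets M2"
      unfolding R1_def R2_def case_prod_beta using \<open>finite S\<close> \<open>finite T\<close> by measurable
    define D1 where "D1 = distr (density M1 (indicator R1)) borel (U1 k)"
    define D2 where "D2 = distr (density M2 (indicator R2)) borel (U2 k)"
    note e1 = emeasure_distr_density_indicator[OF \<open>R1 \<in> sets M1\<close> U1[of k], folded D1_def]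
    note e2 = emeasure_distr_density_indicator[OF \<open>R2 \<in> sets M2\<close> U2[of k], folded D2_def]
    have "D1 = D2"
    proof (rule cdf_unique')
      show "finite_borel_measure D1" "finite_borel_measure D2"
        by (intro finite_borel_measure.intro finite_borel_measure_axioms.intro finite_measureI;
            simp add: D1_def D2_def emeasure_distr_density_indicator)+
      show "cdf D1 = cdf D2"
      proof
        fix b
        have "measure D1 {..b} = measure M1 {\<omega>\<in>space M1. (\<forall>k\<in>S. U1 k \<omega> \<in> A k) \<and> (\<forall>(k, b)\<in>insert (k, b) T. U1 k \<omega> \<le> b)}"
          unfolding measure_def e1[OF borel_closed[OF closed_atMost]] R1_def
          by (intro arg_cong[where f=enn2real] arg_cong[where f="emeasure M1"]) auto
        also have "\<dots> = measure M2 {\<omega>\<in>space M2. (\<forall>k\<in>S. U2 k \<omega> \<in> A k) \<and> (\<forall>(k, b)\<in>insert (k, b) T. U2 k \<omega> \<le> b)}"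
          by (intro insert.IH finite.insertI insert.prems)
        also have "\<dots> = measure D2 {..b}"
          unfolding measure_def e2[OF borel_closed[OF closed_atMost]] R2_def
          by (intro arg_cong[where f=enn2real] arg_cong[where f="emeasure M2"]) auto
        finally show "cdf D1 b = cdf D2 b" by (simp add: cdf_def)
      qed
    qed
    then have "measure D1 (A k) = measure D2 (A k)" by simp
    moreover have "measure D1 (A k) = measure M1 {\<omega>\<in>space M1. (\<forall>k\<in>insert k S. U1 k \<omega> \<in> A k) \<and> (\<forall>(k, b)\<in>T. U1 k \<omega> \<le> b)}"
      unfolding measure_def e1[OF A] R1_def
      by (intro arg_cong[where f=enn2real] arg_cong[where f="emeasure M1"]) auto
    moreover have "measure D2 (A k) = measure M2 {\<omega>\<in>space M2. (\<forall>k\<in>insert k S. U2 k \<omega> \<in> A k) \<and> (\<forall>(k, b)\<in>T. U2 k \<omega> \<le> b)}"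
      unfolding measure_def e2[OF A] R2_def
      by (intro arg_cong[where f=enn2real] arg_cong[where f="emeasure M2"]) auto
    ultimately show ?case by simp
  qed
  show "measure M1 {\<omega>\<in>space M1. \<forall>k\<in>S. U1 k \<omega> \<in> A k} = measure M2 {\<omega>\<in>space M2. \<forall>k\<in>S. U2 k \<omega> \<in> A k}"
    using gen[of "{}"] by simp
qed

section \<open>Exponential tilting of Gaussian families\<close>

lemma char_normal:
  assumes "0 < \<sigma>"
  shows "(CLINT v|density lborel (\<lambda>v. ennreal (normal_density \<mu> \<sigma> v)). iexp (t * v)) =
    iexp (t * \<mu>) * of_real (exp (- (t\<^sup>2 * \<sigma>\<^sup>2) / 2))"
proof -
  have nd: "\<sigma> * normal_density \<mu> \<sigma> (\<mu> + \<sigma> * x) = std_normal_density x" for x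
    using assms by (simp add: normal_density_def real_sqrt_mult field_simps)
  have "(CLINT v|density lborel (\<lambda>v. ennreal (normal_density \<mu> \<sigma> v)). iexp (t * v)) =
      (CLINT v|lborel. normal_density \<mu> \<sigma> v *\<^sub>R iexp (t * v))"
    by (subst integral_density) auto
  also have "\<dots> = \<sigma> *\<^sub>R (CLINT x|lborel. normal_density \<mu> \<sigma> (\<mu> + \<sigma> * x) *\<^sub>R iexp (t * (\<mu> + \<sigma> * x)))"
    using assms by (subst lborel_integral_real_affine[where c=\<sigma> and t=\<mu>]) auto
  also have "\<dots> = (CLINT x|lborel. iexp (t * \<mu>) * (std_normal_density x *\<^sub>R iexp ((t * \<sigma>) * x)))"
    unfolding integral_scaleR_right[symmetric] nd[symmetric]
    by (intro Bochner_Integration.integral_cong refl)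
      (simp add: scaleR_conv_of_real exp_add[symmetric] algebra_simps)
  also have "\<dots> = iexp (t * \<mu>) * (CLINT x|lborel. std_normal_density x *\<^sub>R iexp ((t * \<sigma>) * x))"
    by (rule integral_mult_right_zero)
  also have "\<dots> = iexp (t * \<mu>) * char std_normal_distribution (t * \<sigma>)"
    unfolding char_def by (subst integral_density) auto
  finally show ?thesis
    by (simp add: char_std_normal_distribution power_mult_distrib)
qed

text \<open>Mean zero fixes the location parameter in the normal case as well as in the constant
  case, so that the variance is the only parameter left and both cases share one formula for the
  characteristic function.\<close>

lemma
  assumes "prob_space M" and G: "gaussian_rv M V" and mean: "prob_space.expectation M V = 0"
  shows integrable_gaussian_rv: "integrable M V"
    and integrable_gaussian_rv_square: "integrable M (\<lambda>\<omega>. (V \<omega>)\<^sup>2)"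
    and char_gaussian_rv:
      "(CLINT \<omega>|M. iexp (V \<omega>)) = of_real (exp (- prob_space.variance M V / 2))"
    and gaussian_rv_cases:
      "(AE \<omega> in M. V \<omega> = 0) \<and> prob_space.variance M V = 0 \<or>
       0 < prob_space.variance M V \<and>
        distributed M lborel V (\<lambda>v. ennreal (normal_density 0 (sqrt (prob_space.variance M V)) v))"
proof -
  interpret prob_space M by fact
  have [measurable]: "V \<in> borel_measurable M" using G by (simp add: gaussian_rv_def)
  have "integrable M V \<and> integrable M (\<lambda>\<omega>. (V \<omega>)\<^sup>2) \<and>
    (CLINT \<omega>|M. iexp (V \<omega>)) = of_real (exp (- variance V / 2)) \<and>
    ((AE \<omega> in M. V \<omega> = 0) \<and> variance V = 0 \<or>
       0 < variance V \<and> distributed M lborel V (\<lambda>v. ennreal (normal_density 0 (sqrt (variance V)) v)))"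
    using G unfolding gaussian_rv_def
  proof (elim conjE disjE exE)
    fix \<mu> assume c: "AE \<omega> in M. V \<omega> = \<mu>"
    have "expectation V = expectation (\<lambda>_. \<mu>)" using c by (intro integral_cong_AE) auto
    then have \<mu>: "\<mu> = 0" using mean by (simp add: prob_space)
    have z: "AE \<omega> in M. V \<omega> = 0" using c by (simp add: \<mu>)
    have "integrable M V \<longleftrightarrow> integrable M (\<lambda>_. 0 :: real)"
      by (rule integrable_cong_AE) (use z in auto)
    moreover have "integrable M (\<lambda>\<omega>. (V \<omega>)\<^sup>2) \<longleftrightarrow> integrable M (\<lambda>_. 0 :: real)"
      by (rule integrable_cong_AE) (use z in auto)
    moreover have "variance V = expectation (\<lambda>_. 0)"
      unfolding mean by (rule integral_cong_AE) (use z in auto)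
    moreover have "(CLINT \<omega>|M. iexp (V \<omega>)) = (CLINT \<omega>|M. 1)"
      by (rule integral_cong_AE) (use z in auto)
    ultimately show ?thesis using z by (simp add: prob_space)
  next
    fix \<mu> \<sigma> :: real assume \<sigma>: "0 < \<sigma>" and d: "distributed M lborel V (\<lambda>v. ennreal (normal_density \<mu> \<sigma> v))"
    have "expectation V = \<mu>" using normal_distributed_expectation[OF \<sigma> d] .
    then have \<mu>: "\<mu> = 0" using mean by simp
    have var: "variance V = \<sigma>\<^sup>2" using normal_distributed_variance[OF \<sigma> d] .
    have i1: "integrable M V"
      using integrable_normal_moment_nz_1[OF \<sigma>, of \<mu>] distributed_integrable[OF d, of "\<lambda>x. x"] by simp
    have i2: "integrable M (\<lambda>\<omega>. (V \<omega>)\<^sup>2)"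
      using integrable_normal_moment[OF \<sigma>, of \<mu> 2] distributed_integrable[OF d, of "\<lambda>x. x\<^sup>2"] by (simp add: \<mu>)
    have "distr M borel V = density lborel (\<lambda>v. ennreal (normal_density \<mu> \<sigma> v))"
      using d unfolding distributed_def by (metis distr_cong sets_lborel)
    then have "(CLINT \<omega>|M. iexp (V \<omega>)) = (CLINT v|density lborel (\<lambda>v. ennreal (normal_density \<mu> \<sigma> v)). iexp (1 * v))"
      by (subst \<open>distr M borel V = _\<close>[symmetric]) (subst integral_distr, auto)
    also have "\<dots> = of_real (exp (- variance V / 2))"
      unfolding char_normal[OF \<sigma>] var by (simp add: \<mu>)
    finally have ch: "(CLINT \<omega>|M. iexp (V \<omega>)) = of_real (exp (- variance V / 2))" .
    have "0 < variance V \<and> distributed M lborel V (\<lambda>v. ennreal (normal_density 0 (sqrt (variance V)) v))"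
      using d \<sigma> unfolding var by (simp add: \<mu>)
    with i1 i2 ch show ?thesis by blast
  qed
  then show "integrable M V" "integrable M (\<lambda>\<omega>. (V \<omega>)\<^sup>2)"
    "(CLINT \<omega>|M. iexp (V \<omega>)) = of_real (exp (- variance V / 2))"
    "(AE \<omega> in M. V \<omega> = 0) \<and> variance V = 0 \<or>
       0 < variance V \<and> distributed M lborel V (\<lambda>v. ennreal (normal_density 0 (sqrt (variance V)) v))"
    by auto
qed

text \<open>The index type is left open, so that indices can be components at given times, pairs of
  a component and a threshold, or a single point, and so that increments form a family of the same
  kind.\<close>

locale centered_gaussian_family = prob_space M for M :: "'a measure" +
  fixes G :: "'k \<Rightarrow> 'a \<Rightarrow> real"
  assumes gaussian_lincomb: "gaussian_rv M (lincomb G l)"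
    and mean_zero: "expectation (G k) = 0"
begin

lemma gaussian_component: "gaussian_rv M (G k)"
proof -
  have "lincomb G [(k, 1)] = G k" by (rule ext) simp
  then show ?thesis using gaussian_lincomb[of "[(k, 1)]"] by simp
qed

lemma measurable_component [measurable]: "G k \<in> borel_measurable M"
  using gaussian_component by (simp add: gaussian_rv_def)

lemma integrable_component: "integrable M (G k)"
  by (intro integrable_gaussian_rv gaussian_component mean_zero prob_space_axioms)

lemma integrable_lincomb_component: "integrable M (lincomb G l)"
proof (induction l)
  case Nil
  then show ?case by (simp add: lincomb_def[abs_def])
next
  case (Cons p l)
  obtain k a where "p = (k, a)" by force
  then show ?case using Cons integrable_component[of k] by (simp add: lincomb_Cons[abs_def])
qed

lemma mean_lincomb: "expectation (lincomb G l) = 0"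
proof (induction l)
  case Nil
  then show ?case by (simp add: lincomb_def[abs_def])
next
  case (Cons p l)
  obtain k a where "p = (k, a)" by force
  then show ?case using Cons integrable_component[of k] integrable_lincomb_component[of l]
    by (simp add: lincomb_Cons[abs_def] mean_zero)
qed

text \<open>Polarization: the squares of \<open>G k\<close>, \<open>G l\<close> and of their sum are
  integrable because all three are Gaussian.\<close>

lemma integrable_product: "integrable M (\<lambda>\<omega>. G k \<omega> * G l \<omega>)"
proof -
  have sq: "integrable M (\<lambda>\<omega>. (G k \<omega>)\<^sup>2)" for k
    by (intro integrable_gaussian_rv_square gaussian_component mean_zero prob_space_axioms)
  have "integrable M (\<lambda>\<omega>. (lincomb G [(k, 1), (l, 1)] \<omega>)\<^sup>2)"
    by (intro integrable_gaussian_rv_square gaussian_lincomb mean_lincomb prob_space_axioms)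
  then have "integrable M (\<lambda>\<omega>. ((G k \<omega> + G l \<omega>)\<^sup>2 - (G k \<omega>)\<^sup>2 - (G l \<omega>)\<^sup>2) / 2)"
    using sq[of k] sq[of l] by simp
  then show ?thesis by (simp add: power2_sum)
qed

definition cov :: "'k \<Rightarrow> 'k \<Rightarrow> real" where
  "cov k l = expectation (\<lambda>\<omega>. G k \<omega> * G l \<omega>)"

lemma cov_commute: "cov k l = cov l k"
  by (simp add: cov_def mult.commute)

lemma variance_component: "variance (G k) = cov k k"
  by (simp add: mean_zero cov_def power2_eq_square)

lemma variance_diff: "variance (\<lambda>\<omega>. G k \<omega> - G l \<omega>) = cov k k + cov l l - 2 * cov k l"
proof -
  have "variance (\<lambda>\<omega>. G k \<omega> - G l \<omega>) = expectation (\<lambda>\<omega>. G k \<omega> * G k \<omega> + G l \<omega> * G l \<omega> - 2 * (G k \<omega> * G l \<omega>))"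
    using integrable_component by (simp add: mean_zero power2_eq_square algebra_simps)
  then show ?thesis using integrable_product by (simp add: cov_def)
qed

lemma lincomb_square:
  "(lincomb G l \<omega>)\<^sup>2 = (\<Sum>(k, a)\<leftarrow>l. \<Sum>(k', a')\<leftarrow>l. a * a' * (G k \<omega> * G k' \<omega>))"
  by (simp add: lincomb_def power2_eq_square sum_list_mult_const[symmetric] sum_list_const_mult[symmetric]
      split_def mult_ac)

lemma variance_lincomb:
  "variance (lincomb G l) = (\<Sum>(k, a)\<leftarrow>l. \<Sum>(k', a')\<leftarrow>l. a * a' * cov k k')"
proof -
  have int: "integrable M (\<lambda>\<omega>. \<Sum>x\<leftarrow>l. f x \<omega>) \<and> expectation (\<lambda>\<omega>. \<Sum>x\<leftarrow>l. f x \<omega>) = (\<Sum>x\<leftarrow>l. expectation (f x))"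
    if "\<And>x. integrable M (f x)" for f :: "'x \<Rightarrow> 'a \<Rightarrow> real" and l :: "'x list"
    by (induction l) (use that in auto)
  let ?f = "\<lambda>x y \<omega>. snd x * snd y * (G (fst x) \<omega> * G (fst y) \<omega>)"
  have 1: "integrable M (?f x y)" for x y using integrable_product by simp
  have 2: "integrable M (\<lambda>\<omega>. \<Sum>y\<leftarrow>l. ?f x y \<omega>)" "expectation (\<lambda>\<omega>. \<Sum>y\<leftarrow>l. ?f x y \<omega>) = (\<Sum>y\<leftarrow>l. expectation (?f x y))" for x
    using int[of "?f x"] 1 by auto
  have "variance (lincomb G l) = expectation (\<lambda>\<omega>. \<Sum>x\<leftarrow>l. \<Sum>y\<leftarrow>l. ?f x y \<omega>)"
    unfolding mean_lincomb by (simp add: lincomb_square split_def)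
  also have "\<dots> = (\<Sum>x\<leftarrow>l. expectation (\<lambda>\<omega>. \<Sum>y\<leftarrow>l. ?f x y \<omega>))"
    using int[of "\<lambda>x \<omega>. \<Sum>y\<leftarrow>l. ?f x y \<omega>"] 2(1) by blast
  finally show ?thesis unfolding 2(2) by (simp add: split_def cov_def)
qed

lemma char_lincomb:
  "(CLINT \<omega>|M. iexp (lincomb G l \<omega>)) = of_real (exp (- (\<Sum>(k, a)\<leftarrow>l. \<Sum>(k', a')\<leftarrow>l. a * a' * cov k k') / 2))"
  using char_gaussian_rv[OF prob_space_axioms gaussian_lincomb mean_lincomb]
  unfolding variance_lincomb .

end

section \<open>The Cameron-Martin shift\<close>

lemma nn_integral_normal_exp:
  fixes h :: "real \<Rightarrow> ennreal"
  assumes \<sigma>: "0 < \<sigma>" and [measurable]: "h \<in> borel_measurable borel"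
  defines "D \<equiv> density lborel (\<lambda>v. ennreal (normal_density 0 \<sigma> v))"
  shows "(\<integral>\<^sup>+v. ennreal (exp (v - \<sigma>\<^sup>2 / 2)) * h v \<partial>D) = (\<integral>\<^sup>+v. h (v + \<sigma>\<^sup>2) \<partial>D)"
proof -
  \<comment> \<open>Completing the square: after translation by the variance, the exponential factor
    exactly compensates the change of the normal density.\<close>
  have nd: "normal_density 0 \<sigma> (v + \<sigma>\<^sup>2) * exp (v + \<sigma>\<^sup>2 - \<sigma>\<^sup>2 / 2) = normal_density 0 \<sigma> v" for v
    using \<sigma> by (simp add: normal_density_def mult_exp_exp) (simp add: field_simps power2_eq_square)
  have "(\<integral>\<^sup>+v. ennreal (exp (v - \<sigma>\<^sup>2 / 2)) * h v \<partial>D) =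
      (\<integral>\<^sup>+v. ennreal (normal_density 0 \<sigma> v) * (ennreal (exp (v - \<sigma>\<^sup>2 / 2)) * h v) \<partial>lborel)"
    unfolding D_def by (subst nn_integral_density) auto
  also have "\<dots> = (\<integral>\<^sup>+v. ennreal (normal_density 0 \<sigma> (\<sigma>\<^sup>2 + 1 * v)) * (ennreal (exp (\<sigma>\<^sup>2 + 1 * v - \<sigma>\<^sup>2 / 2)) * h (\<sigma>\<^sup>2 + 1 * v)) \<partial>lborel)"
    by (subst nn_integral_real_affine[where c=1 and t="\<sigma>\<^sup>2"]) auto
  also have "\<dots> = (\<integral>\<^sup>+v. ennreal (normal_density 0 \<sigma> v) * h (v + \<sigma>\<^sup>2) \<partial>lborel)"
    by (intro nn_integral_cong, subst nd[symmetric])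
      (simp add: ennreal_mult mult.assoc add.commute)
  also have "\<dots> = (\<integral>\<^sup>+v. h (v + \<sigma>\<^sup>2) \<partial>D)"
    unfolding D_def by (subst nn_integral_density) auto
  finally show ?thesis .
qed

lemma nn_integral_process_law:
  assumes "\<And>k. U k \<in> borel_measurable M" "f \<in> borel_measurable (\<Pi>\<^sub>M k\<in>UNIV. borel)"
  shows "(\<integral>\<^sup>+y. f y \<partial>process_law M U) = (\<integral>\<^sup>+\<omega>. f (\<lambda>k. U k \<omega>) \<partial>M)"
  unfolding process_law_def
  by (subst nn_integral_distr) (use assms in \<open>auto intro!: measurable_PiM_single'\<close>)

lemma measurable_process_function:
  assumes "\<And>k. U k \<in> borel_measurable M" "f \<in> borel_measurable (\<Pi>\<^sub>M k\<in>UNIV. borel)"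
  shows "(\<lambda>\<omega>. f (\<lambda>k. U k \<omega>)) \<in> borel_measurable M"
  by (rule measurable_compose[OF _ assms(2)]) (use assms(1) in \<open>auto intro!: measurable_PiM_single'\<close>)

context centered_gaussian_family
begin

text \<open>
  \<open>G k - \<beta> k * G p\<close> is uncorrelated with \<open>G p\<close>, so \<open>G p\<close> may be replaced by an independent copy \<open>v\<close>.
\<close>

lemma process_law_regression:
  assumes "0 < cov p p"
  defines "\<beta> \<equiv> \<lambda>k. cov k p / cov p p"
  defines "D \<equiv> density lborel (\<lambda>v. ennreal (normal_density 0 (sqrt (cov p p)) v))"
  shows "process_law M G = process_law (M \<Otimes>\<^sub>M D) (\<lambda>k (\<omega>, v). G k \<omega> + \<beta> k * (v - G p \<omega>))"
proof (rule process_law_eqI_char)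
  interpret D: prob_space D unfolding D_def using assms by (intro prob_space_normal_density) simp
  interpret MD: pair_prob_space M D ..
  have [measurable_cong]: "sets D = sets borel" by (simp add: D_def)
  let ?H = "\<lambda>k (\<omega>, v). G k \<omega> + \<beta> k * (v - G p \<omega>)"
  show "?H k \<in> borel_measurable (M \<Otimes>\<^sub>M D)" for k by measurable
  show "prob_space M" "prob_space (M \<Otimes>\<^sub>M D)" by unfold_locales
  fix l
  \<comment> \<open>\<open>b\<close> is the regression coefficient of the whole combination on
    \<open>G p\<close>; the combination becomes its residual plus \<open>b * v\<close>.\<close>
  define b where "b = (\<Sum>(k, a)\<leftarrow>l. a * \<beta> k)"
  have H: "lincomb ?H l (\<omega>, v) = lincomb G ((p, - b) # l) \<omega> + b * v" for \<omega> v
    unfolding b_def by (induction l) (auto simp: algebra_simps)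
  have bc: "(\<Sum>(k, a)\<leftarrow>l. a * cov k p) = b * cov p p"
    using assms(1) unfolding b_def \<beta>_def by (induction l) (auto simp: field_simps)
  have s1: "(\<Sum>(k, a)\<leftarrow>l. a * b * cov k p) = b * (b * cov p p)"
    unfolding bc[symmetric] by (induction l) (auto simp: algebra_simps)
  have s2: "(\<Sum>(k, a)\<leftarrow>l. - (b * a) * cov p k) = - (b * (b * cov p p))"
    unfolding bc[symmetric] by (induction l) (auto simp: algebra_simps cov_commute)
  \<comment> \<open>Passing to the residual lowers the variance by
    \<open>b\<^sup>2 * cov p p\<close>, which is what the independent term \<open>b * v\<close>
    contributes.\<close>
  have var: "(\<Sum>(k, a)\<leftarrow>(p, - b) # l. \<Sum>(k', a')\<leftarrow>(p, - b) # l. a * a' * cov k k') =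
     (\<Sum>(k, a)\<leftarrow>l. \<Sum>(k', a')\<leftarrow>l. a * a' * cov k k') - b\<^sup>2 * cov p p"
    using s1 s2 by (simp add: split_def sum_list_addf sum_list_subtractf power2_eq_square)
  have "(CLINT x|M \<Otimes>\<^sub>M D. iexp (lincomb ?H l x)) = (CLINT \<omega>|M. CLINT v|D. iexp (lincomb ?H l (\<omega>, v)))"
    by (rule MD.integral_fst'[symmetric])
      (auto intro!: MD.integrable_const_bound[where B=1] measurable_lincomb)
  also have "\<dots> = (CLINT \<omega>|M. iexp (lincomb G ((p, - b) # l) \<omega>) * (CLINT v|D. iexp (b * v)))"
    unfolding H iexp_add by (simp only: integral_mult_right_zero)
  also have "\<dots> = (CLINT \<omega>|M. iexp (lincomb G ((p, - b) # l) \<omega>)) * (CLINT v|D. iexp (b * v))"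
    by (rule integral_mult_left_zero)
  also have "(CLINT v|D. iexp (b * v)) = of_real (exp (- (b\<^sup>2 * cov p p) / 2))"
    unfolding D_def using assms(1) by (subst char_normal) auto
  also have "(CLINT \<omega>|M. iexp (lincomb G ((p, - b) # l) \<omega>)) * of_real (exp (- (b\<^sup>2 * cov p p) / 2)) =
      (CLINT \<omega>|M. iexp (lincomb G l \<omega>))"
    unfolding char_lincomb var by (simp flip: of_real_mult exp_add add: field_simps)
  finally show "(CLINT \<omega>|M. iexp (lincomb G l \<omega>)) = (CLINT x|M \<Otimes>\<^sub>M D. iexp (lincomb ?H l x))" ..
qed simp

text \<open>In the regression representation the weight depends on \<open>v\<close> alone, so the
  one-dimensional shift of \<open>v\<close> by \<open>cov p p\<close> suffices; it moves coordinate
  \<open>k\<close> by \<open>\<beta> k * cov p p\<close>, which is \<open>cov k p\<close>. If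
  \<open>G p\<close> is degenerate, the weight is 1 almost surely and all these covariances
  vanish.\<close>

theorem exponential_tilt:
  assumes f: "f \<in> borel_measurable (\<Pi>\<^sub>M k\<in>UNIV. borel)"
  shows "(\<integral>\<^sup>+\<omega>. ennreal (exp (G p \<omega> - cov p p / 2)) * f (\<lambda>k. G k \<omega>) \<partial>M) =
    (\<integral>\<^sup>+\<omega>. f (\<lambda>k. G k \<omega> + cov k p) \<partial>M)"
proof (rule disjE[OF gaussian_rv_cases[OF prob_space_axioms gaussian_component[of p] mean_zero]])
  assume z: "(AE \<omega> in M. G p \<omega> = 0) \<and> variance (G p) = 0"
  have "cov k p = 0" for k
  proof -
    have "cov k p = expectation (\<lambda>_. 0)"
      unfolding cov_def by (intro integral_cong_AE) (use z in auto)
    then show ?thesis by simp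
  qed
  then show ?thesis
    by (intro nn_integral_cong_AE) (use z in auto)
next
  assume "0 < variance (G p) \<and> distributed M lborel (G p) (\<lambda>v. ennreal (normal_density 0 (sqrt (variance (G p))) v))"
  then have pos: "0 < cov p p" by (simp add: variance_component)
  define \<sigma> where "\<sigma> = sqrt (cov p p)"
  have \<sigma>: "0 < \<sigma>" "\<sigma>\<^sup>2 = cov p p" using pos by (auto simp: \<sigma>_def)
  define \<beta> where "\<beta> k = cov k p / cov p p" for k
  define D where "D = density lborel (\<lambda>v. ennreal (normal_density 0 \<sigma> v))"
  interpret D: prob_space D unfolding D_def using \<sigma> by (intro prob_space_normal_density) simp
  have [measurable_cong]: "sets D = sets borel" by (simp add: D_def)
  define H where "H k = (\<lambda>(\<omega>, v). G k \<omega> + \<beta> k * (v - G p \<omega>))" for k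
  have [measurable]: "H k \<in> borel_measurable (M \<Otimes>\<^sub>M D)" for k
    unfolding H_def by measurable
  have H: "H p (\<omega>, v) = v" "H k (\<omega>, v + \<sigma>\<^sup>2) = H k (\<omega>, v) + cov k p" for \<omega> v k
    using pos \<sigma> by (auto simp: H_def \<beta>_def field_simps)
  have law: "process_law M G = process_law (M \<Otimes>\<^sub>M D) H"
    using process_law_regression[OF pos] unfolding H_def[abs_def] D_def \<sigma>_def \<beta>_def .
  have [measurable]: "(\<lambda>x. f (\<lambda>k. U k x)) \<in> borel_measurable N"
    if "\<And>k. U k \<in> borel_measurable N" for U :: "'k \<Rightarrow> 'a \<times> real \<Rightarrow> real" and N
    using measurable_process_function[OF that f] .
  have tilt_meas: "(\<lambda>y. ennreal (exp (y p - cov p p / 2)) * f y) \<in> borel_measurable (\<Pi>\<^sub>M k\<in>UNIV. borel)"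
    using f by measurable
  have shift_meas: "(\<lambda>y. f (\<lambda>k. y k + cov k p)) \<in> borel_measurable (\<Pi>\<^sub>M k\<in>UNIV. borel)"
    by (rule measurable_process_function[OF _ f]) measurable
  have "(\<integral>\<^sup>+\<omega>. ennreal (exp (G p \<omega> - cov p p / 2)) * f (\<lambda>k. G k \<omega>) \<partial>M) =
      (\<integral>\<^sup>+x. ennreal (exp (H p x - cov p p / 2)) * f (\<lambda>k. H k x) \<partial>(M \<Otimes>\<^sub>M D))"
    using nn_integral_process_law[where U=G, OF measurable_component tilt_meas] nn_integral_process_law[OF _ tilt_meas, of H "M \<Otimes>\<^sub>M D"]
    unfolding law by simp
  also have "\<dots> = (\<integral>\<^sup>+\<omega>. \<integral>\<^sup>+v. ennreal (exp (v - \<sigma>\<^sup>2 / 2)) * f (\<lambda>k. H k (\<omega>, v)) \<partial>D \<partial>M)"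
    by (subst D.nn_integral_fst[symmetric]) (auto simp: H \<sigma>)
  also have "\<dots> = (\<integral>\<^sup>+\<omega>. \<integral>\<^sup>+v. f (\<lambda>k. H k (\<omega>, v + \<sigma>\<^sup>2)) \<partial>D \<partial>M)"
  proof (rule nn_integral_cong)
    fix \<omega>
    have "(\<lambda>v. f (\<lambda>k. H k (\<omega>, v))) \<in> borel_measurable borel"
      by (rule measurable_process_function[OF _ f]) (auto simp: H_def)
    then show "(\<integral>\<^sup>+v. ennreal (exp (v - \<sigma>\<^sup>2 / 2)) * f (\<lambda>k. H k (\<omega>, v)) \<partial>D) = (\<integral>\<^sup>+v. f (\<lambda>k. H k (\<omega>, v + \<sigma>\<^sup>2)) \<partial>D)"
      unfolding D_def by (rule nn_integral_normal_exp[OF \<sigma>(1)])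
  qed
  also have "\<dots> = (\<integral>\<^sup>+x. f (\<lambda>k. H k x + cov k p) \<partial>(M \<Otimes>\<^sub>M D))"
    by (subst D.nn_integral_fst[symmetric]) (auto simp: H)
  also have "\<dots> = (\<integral>\<^sup>+\<omega>. f (\<lambda>k. G k \<omega> + cov k p) \<partial>M)"
    using nn_integral_process_law[where U=G, OF measurable_component shift_meas] nn_integral_process_law[OF _ shift_meas, of H "M \<Otimes>\<^sub>M D"]
    unfolding law by simp
  finally show ?thesis .
qed

text \<open>The shift adds \<open>cov k p - cov p p\<close> to the difference. Together with the two
  centering terms this makes minus half of \<open>cov k k + cov p p - 2 * cov k p\<close>, the
  variance of the increment, so no individual variance survives.\<close>

lemma exponential_tilt_increments:
  assumes f: "f \<in> borel_measurable (\<Pi>\<^sub>M k\<in>UNIV. borel)"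
  shows "(\<integral>\<^sup>+\<omega>. ennreal (exp (G p \<omega> - cov p p / 2)) * f (\<lambda>k. (G k \<omega> - cov k k / 2) - (G p \<omega> - cov p p / 2)) \<partial>M) =
    (\<integral>\<^sup>+\<omega>. f (\<lambda>k. G k \<omega> - G p \<omega> - variance (\<lambda>\<omega>. G k \<omega> - G p \<omega>) / 2) \<partial>M)"
proof -
  have "(\<lambda>y. f (\<lambda>k. (y k - cov k k / 2) - (y p - cov p p / 2))) \<in> borel_measurable (\<Pi>\<^sub>M k\<in>UNIV. borel)"
    by (rule measurable_process_function[OF _ f]) measurable
  note tilt = exponential_tilt[OF this, of p]
  have eq: "(G k \<omega> + cov k p - cov k k / 2) - (G p \<omega> + cov p p - cov p p / 2) =
      G k \<omega> - G p \<omega> - (cov k k + cov p p - 2 * cov k p) / 2" for k \<omega>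
    by (simp add: field_simps)
  show ?thesis
    unfolding variance_diff eq[symmetric] by (rule tilt)
qed

lemma nn_integral_exp_component: "(\<integral>\<^sup>+\<omega>. ennreal (exp (G p \<omega> - cov p p / 2)) \<partial>M) = 1"
  using exponential_tilt[of "\<lambda>_. 1" p] by (simp add: emeasure_space_1)

section \<open>The law of the increments\<close>

lemma increments_gaussian: "centered_gaussian_family M (\<lambda>k \<omega>. G k \<omega> - G p \<omega>)"
proof
  fix l
  have "lincomb (\<lambda>k \<omega>. G k \<omega> - G p \<omega>) l = lincomb G ((p, - (\<Sum>(k, a)\<leftarrow>l. a)) # l)"
    by (rule ext, induction l) (auto simp: algebra_simps)
  then show "gaussian_rv M (lincomb (\<lambda>k \<omega>. G k \<omega> - G p \<omega>) l)"
    using gaussian_lincomb by simp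
  show "expectation (\<lambda>\<omega>. G k \<omega> - G p \<omega>) = 0" for k
    using integrable_component by (simp add: mean_zero)
qed

text \<open>Polarization once more: the difference of two increments from \<open>p\<close> is the
  increment between \<open>k\<close> and \<open>l\<close>. Here the covariance structure is
  expressed through the variogram alone.\<close>

lemma cov_increments:
  "centered_gaussian_family.cov M (\<lambda>k \<omega>. G k \<omega> - G p \<omega>) k l =
    (variance (\<lambda>\<omega>. G k \<omega> - G p \<omega>) + variance (\<lambda>\<omega>. G l \<omega> - G p \<omega>) - variance (\<lambda>\<omega>. G k \<omega> - G l \<omega>)) / 2"
proof -
  interpret I: centered_gaussian_family M "\<lambda>k \<omega>. G k \<omega> - G p \<omega>" by (rule increments_gaussian)
  have "I.cov k l = expectation (\<lambda>\<omega>. G k \<omega> * G l \<omega> - G k \<omega> * G p \<omega> - G p \<omega> * G l \<omega> + G p \<omega> * G p \<omega>)"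
    unfolding I.cov_def by (simp add: algebra_simps)
  also have "\<dots> = cov k l - cov k p - cov p l + cov p p"
    using integrable_product by (simp add: cov_def)
  finally show ?thesis unfolding variance_diff using cov_commute[of p l] by simp
qed

end

lemma increments_law_eq:
  assumes "centered_gaussian_family M G" "centered_gaussian_family M' G'"
    and var: "\<And>k l. prob_space.variance M (\<lambda>\<omega>. G k \<omega> - G l \<omega>) = prob_space.variance M' (\<lambda>\<omega>. G' k \<omega> - G' l \<omega>)"
  shows "process_law M (\<lambda>k \<omega>. G k \<omega> - G p \<omega>) = process_law M' (\<lambda>k \<omega>. G' k \<omega> - G' p \<omega>)"
proof -
  interpret G: centered_gaussian_family M G by fact
  interpret G': centered_gaussian_family M' G' by fact
  interpret I: centered_gaussian_family M "\<lambda>k \<omega>. G k \<omega> - G p \<omega>" by (rule G.increments_gaussian)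
  interpret I': centered_gaussian_family M' "\<lambda>k \<omega>. G' k \<omega> - G' p \<omega>" by (rule G'.increments_gaussian)
  show ?thesis
  proof (rule process_law_eqI_char)
    have "I.cov k l = I'.cov k l" for k l
      unfolding G.cov_increments G'.cov_increments var ..
    then show "(CLINT \<omega>|M. iexp (lincomb (\<lambda>k \<omega>. G k \<omega> - G p \<omega>) l \<omega>)) =
        (CLINT \<omega>|M'. iexp (lincomb (\<lambda>k \<omega>. G' k \<omega> - G' p \<omega>) l \<omega>))" for l
      unfolding I.char_lincomb I'.char_lincomb by simp
  qed (auto intro: G.prob_space_axioms G'.prob_space_axioms)
qed

section \<open>Void probabilities of marked Poisson arrivals\<close>

lemma nn_integral_exp_atLeast:
  fixes c :: real assumes "0 < c"
  shows "(\<integral>\<^sup>+v. ennreal (exp (- (c * v))) * indicator {s..} v \<partial>lborel) = ennreal (exp (- (c * s)) / c)"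
proof -
  have "((\<lambda>v. - (exp (- (c * v)) / c)) \<longlongrightarrow> 0) at_top"
    using assms by real_asymp
  then have "(\<integral>\<^sup>+v. ennreal (exp (- (c * v))) * indicator {s..} v \<partial>lborel) = ennreal (0 - - (exp (- (c * s)) / c))"
    by (intro nn_integral_FTC_atLeast) (use assms in \<open>auto intro!: derivative_eq_intros\<close>)
  then show ?thesis by simp
qed

abbreviation unit_exponential :: "real measure" where
  "unit_exponential \<equiv> density lborel (\<lambda>v. ennreal (exponential_density 1 v))"

lemma nn_integral_unit_exponential:
  assumes [measurable]: "f \<in> borel_measurable borel"
  shows "(\<integral>\<^sup>+u. f (s + u) \<partial>unit_exponential) =
    (\<integral>\<^sup>+v. ennreal (exp (s - v)) * indicator {s..} v * f v \<partial>lborel)"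
proof -
  have "(\<integral>\<^sup>+v. ennreal (exp (s - v)) * indicator {s..} v * f v \<partial>lborel) =
     (\<integral>\<^sup>+u. ennreal (exp (- u)) * indicator {s..} (s + u) * f (s + u) \<partial>lborel)"
    by (subst nn_integral_real_affine[where c=1 and t=s]) auto
  also have "\<dots> = (\<integral>\<^sup>+u. f (s + u) \<partial>unit_exponential)"
    by (subst nn_integral_density)
      (auto intro!: nn_integral_cong simp: exponential_density_def indicator_def)
  finally show ?thesis ..
qed

text \<open>
  \<open>survival F n s\<close> is the probability that the first \<open>n\<close> points of a Poisson process on \<open>{s..}\<close> with independent
  marks of distribution function \<open>F\<close> all dominate their marks.
\<close>

definition survival :: "(real \<Rightarrow> real) \<Rightarrow> nat \<Rightarrow> real \<Rightarrow> ennreal" where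
  "survival F n s = (\<integral>\<^sup>+e. (\<Prod>m<n. ennreal (F (s + (\<Sum>k\<le>m. e k)))) \<partial>(\<Pi>\<^sub>M k\<in>UNIV. unit_exponential))"

lemma prob_space_unit_exponential: "prob_space unit_exponential"
  by (rule prob_space_exponential_density) simp

lemma survival_0: "survival F 0 s = 1"
proof -
  interpret product_prob_space "\<lambda>_. unit_exponential" "UNIV :: nat set"
    by (intro product_prob_spaceI prob_space_unit_exponential)
  show ?thesis by (simp add: survival_def emeasure_space_1)
qed

text \<open>Conditioning on the first gap \<open>u\<close>: the first point lies at
  \<open>s + u\<close> and contributes one factor, and the remaining gaps are again independent unit
  exponentials, started from \<open>s + u\<close>.\<close>

lemma
  assumes [measurable]: "F \<in> borel_measurable borel"
  shows survival_Suc: "survival F (Suc n) s = (\<integral>\<^sup>+u. ennreal (F (s + u)) * survival F n (s + u) \<partial>unit_exponential)"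
    and measurable_survival [measurable]: "survival F n \<in> borel_measurable borel"
proof -
  interpret X: prob_space unit_exponential by (rule prob_space_unit_exponential)
  interpret S: sequence_space unit_exponential ..
  let ?S = "\<Pi>\<^sub>M k\<in>(UNIV::nat set). unit_exponential"
  have [measurable_cong]: "sets unit_exponential = sets borel" by simp
  have m: "(\<lambda>(s, e). \<Prod>m<n. ennreal (F (s + (\<Sum>k\<le>m. e k)))) \<in> borel_measurable (borel \<Otimes>\<^sub>M ?S)" for n
    by measurable
  show "survival F n \<in> borel_measurable borel"
    unfolding survival_def using S.borel_measurable_nn_integral[OF m[of n]] .
  define G where "G u e = (\<Prod>m<Suc n. ennreal (F (s + (\<Sum>k\<le>m. case_nat u e k))))" for u :: real and e
  have G: "G u e = ennreal (F (s + u)) * (\<Prod>m<n. ennreal (F (s + u + (\<Sum>k\<le>m. e k))))" for u e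
    unfolding G_def
    by (simp add: prod.lessThan_Suc_shift sum.atMost_Suc_shift add.assoc del: prod.lessThan_Suc sum.atMost_Suc)
  have [measurable]: "case_prod G \<in> borel_measurable (unit_exponential \<Otimes>\<^sub>M ?S)"
    unfolding G by measurable
  have "survival F (Suc n) s = (\<integral>\<^sup>+e. (\<Prod>m<Suc n. ennreal (F (s + (\<Sum>k\<le>m. e k))))
      \<partial>distr (unit_exponential \<Otimes>\<^sub>M ?S) ?S (\<lambda>(u, e). case_nat u e))"
    unfolding S.PiM_iter survival_def ..
  also have "\<dots> = (\<integral>\<^sup>+x. case_prod G x \<partial>(unit_exponential \<Otimes>\<^sub>M ?S))"
    by (subst nn_integral_distr) (auto simp: split_beta' G_def simp del: prod.lessThan_Suc)
  also have "\<dots> = (\<integral>\<^sup>+u. \<integral>\<^sup>+e. G u e \<partial>?S \<partial>unit_exponential)"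
    by (subst S.nn_integral_fst[symmetric]) auto
  also have "\<dots> = (\<integral>\<^sup>+u. \<integral>\<^sup>+e. ennreal (F (s + u)) * (\<Prod>m<n. ennreal (F (s + u + (\<Sum>k\<le>m. e k)))) \<partial>?S \<partial>unit_exponential)"
    unfolding G ..
  also have "\<dots> = (\<integral>\<^sup>+u. ennreal (F (s + u)) * survival F n (s + u) \<partial>unit_exponential)"
    unfolding survival_def by (intro nn_integral_cong nn_integral_cmult) measurable
  finally show "survival F (Suc n) s = (\<integral>\<^sup>+u. ennreal (F (s + u)) * survival F n (s + u) \<partial>unit_exponential)" .
qed

section \<open>The void probability as a fixed point\<close>

locale integrable_variable = N: prob_space N for N :: "'b measure" +
  fixes W :: "'b \<Rightarrow> real"
  assumes integrable_W: "integrable N W"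
begin

definition dist_fun :: "real \<Rightarrow> real" where
  "dist_fun v = measure N {\<omega>\<in>space N. W \<omega> \<le> v}"

definition mean_max :: "real \<Rightarrow> real" where
  "mean_max s = (LINT \<omega>|N. max s (W \<omega>))"

text \<open>The exponent is - E (W - s)^+, minus the mean number of points with \<gamma> < w of a
  unit-rate Poisson process on \<open>{s..}\<close> with marks distributed as
  \<open>W\<close>.\<close>

definition void_prob :: "real \<Rightarrow> real" where
  "void_prob s = exp (s - mean_max s)"

lemma measurable_W [measurable]: "W \<in> borel_measurable N"
  using integrable_W by auto

lemma integrable_max_W: "integrable N (\<lambda>\<omega>. max s (W \<omega>))"
  using integrable_W by auto

lemma mean_max_ge: "s \<le> mean_max s"
proof -
  have "(LINT \<omega>|N. s) \<le> mean_max s" unfolding mean_max_def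
    by (intro integral_mono integrable_max_W) auto
  then show ?thesis by (simp add: N.prob_space)
qed

lemma mean_max_mono: "s \<le> s' \<Longrightarrow> mean_max s \<le> mean_max s'"
  unfolding mean_max_def by (intro integral_mono integrable_max_W) auto

lemma mean_max_le: assumes "0 \<le> h" shows "mean_max (s + h) \<le> mean_max s + h"
proof -
  have "mean_max (s + h) \<le> (LINT \<omega>|N. max s (W \<omega>) + h)" unfolding mean_max_def
    using assms by (intro integral_mono integrable_max_W Bochner_Integration.integrable_add) auto
  also have "\<dots> = mean_max s + h"
    unfolding mean_max_def using integrable_max_W by (subst Bochner_Integration.integral_add) (auto simp: N.prob_space)
  finally show ?thesis .
qed

lemma dist_fun_nonneg: "0 \<le> dist_fun v" and dist_fun_le_1: "dist_fun v \<le> 1"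
  by (auto simp: dist_fun_def)

lemma dist_fun_mono: "v \<le> v' \<Longrightarrow> dist_fun v \<le> dist_fun v'"
  unfolding dist_fun_def by (intro N.finite_measure_mono) auto

lemma measurable_dist_fun [measurable]: "dist_fun \<in> borel_measurable borel"
  by (rule borel_measurable_mono) (auto simp: mono_def dist_fun_mono)

lemma measurable_mean_max [measurable]: "mean_max \<in> borel_measurable borel"
  by (rule borel_measurable_mono) (auto simp: mono_def mean_max_mono)

text \<open>Where \<open>W \<omega> \<le> v\<close> the difference quotient equals 1; where
  \<open>W \<omega> > v\<close> it is eventually 0. It is bounded by 1, so dominated convergence
  applies. Taking the derivative from the right is what produces the weak inequality in
  \<open>dist_fun\<close>, even at atoms of \<open>W\<close>.\<close>

lemma mean_max_right_derivative:
  "(\<lambda>k. real (Suc k) * (mean_max (v + inverse (real (Suc k))) - mean_max v)) \<longlonglongrightarrow> dist_fun v"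
proof -
  have "(\<lambda>k. LINT \<omega>|N. real (Suc k) * (max (v + inverse (real (Suc k))) (W \<omega>) - max v (W \<omega>)))
      \<longlonglongrightarrow> (LINT \<omega>|N. indicator {\<omega>\<in>space N. W \<omega> \<le> v} \<omega>)"
  proof (rule integral_dominated_convergence[where w="\<lambda>_. 1"])
    show "AE \<omega> in N. (\<lambda>k. real (Suc k) * (max (v + inverse (real (Suc k))) (W \<omega>) - max v (W \<omega>)))
      \<longlonglongrightarrow> indicator {\<omega>\<in>space N. W \<omega> \<le> v} \<omega>"
    proof (rule AE_I2)
      fix \<omega> assume \<omega>: "\<omega> \<in> space N"
      show "(\<lambda>k. real (Suc k) * (max (v + inverse (real (Suc k))) (W \<omega>) - max v (W \<omega>)))
        \<longlonglongrightarrow> indicator {\<omega>\<in>space N. W \<omega> \<le> v} \<omega>"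
      proof (cases "W \<omega> \<le> v")
        case True
        then have "max (v + inverse (real (Suc k))) (W \<omega>) - max v (W \<omega>) = inverse (real (Suc k))" for k
          by (simp add: max_def add_increasing2) (smt (verit) inverse_nonnegative_iff_nonnegative of_nat_0_le_iff)
        then have "real (Suc k) * (max (v + inverse (real (Suc k))) (W \<omega>) - max v (W \<omega>)) = 1" for k
          by simp
        then show ?thesis using True \<omega> by simp
      next
        case False
        have "\<forall>\<^sub>F k in sequentially. inverse (real (Suc k)) < W \<omega> - v"
          using False by (intro order_tendstoD[OF LIMSEQ_inverse_real_of_nat]) auto
        then have "\<forall>\<^sub>F k in sequentially.
            real (Suc k) * (max (v + inverse (real (Suc k))) (W \<omega>) - max v (W \<omega>)) = 0"
          by eventually_elim (use False in auto)
        then show ?thesis using False by (simp add: tendsto_eventually)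
      qed
    qed
    show "AE \<omega> in N. norm (real (Suc k) * (max (v + inverse (real (Suc k))) (W \<omega>) - max v (W \<omega>))) \<le> 1" for k
    proof (rule AE_I2)
      fix \<omega>
      have "\<bar>max (v + inverse (real (Suc k))) (W \<omega>) - max v (W \<omega>)\<bar> \<le> inverse (real (Suc k))"
        by (smt (verit) inverse_nonnegative_iff_nonnegative of_nat_0_le_iff)
      then have "real (Suc k) * \<bar>max (v + inverse (real (Suc k))) (W \<omega>) - max v (W \<omega>)\<bar>
          \<le> real (Suc k) * inverse (real (Suc k))"
        by (intro mult_left_mono) auto
      then show "norm (real (Suc k) * (max (v + inverse (real (Suc k))) (W \<omega>) - max v (W \<omega>))) \<le> 1"
        by (simp add: abs_mult)
    qed
  qed simp_all
  then show ?thesis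
    unfolding dist_fun_def mean_max_def using integrable_max_W by simp
qed

text \<open>
  The right derivative of \<open>\<lambda>v. exp (- mean_max v)\<close> is \<open>- dist_fun v * exp (- mean_max v)\<close>; since \<open>dist_fun\<close> may jump, the
  fundamental theorem of calculus is replaced by dominated convergence for difference quotients.
\<close>

lemma integral_dist_fun_exp:
  "(\<integral>\<^sup>+v. ennreal (dist_fun v * exp (- mean_max v)) * indicator {s..} v \<partial>lborel) = ennreal (exp (- mean_max s))"
proof -
  define \<phi> where "\<phi> v = exp (- mean_max v)" for v
  define h where "h k = inverse (real (Suc k))" for k
  have h: "0 < h k" "real (Suc k) * h k = 1" for k by (auto simp: h_def)
  have h0: "h \<longlonglongrightarrow> 0" unfolding h_def by (rule LIMSEQ_inverse_real_of_nat)
  have [measurable]: "\<phi> \<in> borel_measurable borel" unfolding \<phi>_def by measurable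
  have pos: "0 < \<phi> v" for v by (simp add: \<phi>_def)
  have anti: "\<phi> v' \<le> \<phi> v" if "v \<le> v'" for v v'
    using mean_max_mono[OF that] by (simp add: \<phi>_def)
  have le: "\<phi> v \<le> exp (- v)" for v using mean_max_ge[of v] by (simp add: \<phi>_def)
  have int_exp: "integrable lborel (\<lambda>v. exp (- v) * indicator {s..} v :: real)" for s
    using nn_integral_exp_atLeast[of 1 s]
    by (intro integrableI_nonneg) (auto simp: ennreal_mult'' ennreal_indicator)
  have int: "integrable lborel (\<lambda>v. \<phi> v * indicator {s..} v)" for s
    by (rule Bochner_Integration.integrable_bound[OF int_exp[of s]])
      (use le pos in \<open>auto simp: indicator_def less_imp_le\<close>)
  have int': "integrable lborel (\<lambda>v. \<phi> (v + h k) * indicator {s..} v)" for k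
    by (rule Bochner_Integration.integrable_bound[OF int_exp[of s]])
      (use order_trans[OF anti le] pos h in \<open>auto simp: indicator_def less_imp_le\<close>)
  have d0: "0 \<le> mean_max (v + h k) - mean_max v" and d1: "mean_max (v + h k) - mean_max v \<le> h k" for v k
    using mean_max_mono[of v "v + h k"] mean_max_le[of "h k" v] h(1)[of k] by auto
  \<comment> \<open>This factorization yields both the pointwise limit and the dominating function
    of the difference quotients.\<close>
  have diff: "\<phi> v - \<phi> (v + h k) = \<phi> v * (1 - exp (- (mean_max (v + h k) - mean_max v)))" for v k
    unfolding \<phi>_def by (simp add: right_diff_distrib flip: exp_add)
  have lim: "(\<lambda>k. real (Suc k) * (\<phi> v - \<phi> (v + h k))) \<longlonglongrightarrow> dist_fun v * \<phi> v" for v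
  proof -
    define d where "d k = mean_max (v + h k) - mean_max v" for k
    have d: "0 \<le> d k" for k using d0 by (simp add: d_def)
    have "d \<longlonglongrightarrow> 0"
      by (rule tendsto_sandwich[OF _ _ tendsto_const h0]) (use d d1 in \<open>auto simp: d_def\<close>)
    moreover have kd: "(\<lambda>k. real (Suc k) * d k) \<longlonglongrightarrow> dist_fun v"
      using mean_max_right_derivative[of v] by (simp add: d_def h_def)
    \<comment> \<open>Linearization of the exponential by a squeeze: d / (1 + d) \<le> 1 - exp (- d)
      \<le> d, where \<open>d\<close> tends to 0 and its quotient by \<open>h k\<close> tends to
      \<open>dist_fun v\<close>.\<close>
    ultimately have "(\<lambda>k. real (Suc k) * d k / (1 + d k)) \<longlonglongrightarrow> dist_fun v / (1 + 0)"
      by (intro tendsto_intros) auto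
    then have lo: "(\<lambda>k. real (Suc k) * d k / (1 + d k)) \<longlonglongrightarrow> dist_fun v" by simp
    have b1: "1 - exp (- d k) \<le> d k" for k
      using exp_ge_add_one_self[of "- d k"] by linarith
    have b2: "d k / (1 + d k) \<le> 1 - exp (- d k)" for k
    proof -
      have "exp (- d k) \<le> 1 / (1 + d k)"
        using exp_ge_add_one_self[of "d k"] d[of k] by (simp add: exp_minus field_simps)
      then show ?thesis using d[of k] by (simp add: field_simps)
    qed
    have "(\<lambda>k. real (Suc k) * (1 - exp (- d k))) \<longlonglongrightarrow> dist_fun v"
    proof (rule tendsto_sandwich[OF _ _ lo kd])
      show "\<forall>\<^sub>F k in sequentially. real (Suc k) * d k / (1 + d k) \<le> real (Suc k) * (1 - exp (- d k))"
        using mult_left_mono[OF b2, of "real (Suc _)"] by (intro always_eventually allI) (simp only: times_divide_eq_right of_nat_0_le_iff)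
      show "\<forall>\<^sub>F k in sequentially. real (Suc k) * (1 - exp (- d k)) \<le> real (Suc k) * d k"
        by (intro always_eventually allI mult_left_mono b1) simp
    qed
    from tendsto_mult_left[OF this, of "\<phi> v"] show ?thesis
      unfolding diff d_def by (simp add: mult_ac)
  qed
  \<comment> \<open>Since \<open>mean_max\<close> has slope at most 1, the quotient is at most
    \<open>\<phi> v\<close>, hence at most \<open>exp (- v)\<close>, which is integrable on
    \<open>{s..}\<close>.\<close>
  have bd: "0 \<le> real (Suc k) * (\<phi> v - \<phi> (v + h k))" "real (Suc k) * (\<phi> v - \<phi> (v + h k)) \<le> exp (- v)" for k v
  proof -
    show "0 \<le> real (Suc k) * (\<phi> v - \<phi> (v + h k))"
      using anti[of v "v + h k"] h(1)[of k] by (intro mult_nonneg_nonneg) auto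
    have "1 - exp (- (mean_max (v + h k) - mean_max v)) \<le> h k"
      using exp_ge_add_one_self[of "- (mean_max (v + h k) - mean_max v)"] d1[of v k] by linarith
    then have "real (Suc k) * (1 - exp (- (mean_max (v + h k) - mean_max v))) \<le> 1"
      using mult_left_mono[of _ "h k" "real (Suc k)"] h(2)[of k] by fastforce
    then have "\<phi> v * (real (Suc k) * (1 - exp (- (mean_max (v + h k) - mean_max v)))) \<le> \<phi> v * 1"
      using pos[of v] by (intro mult_left_mono) auto
    then show "real (Suc k) * (\<phi> v - \<phi> (v + h k)) \<le> exp (- v)"
      unfolding diff using le[of v] by (simp add: mult_ac)
  qed
  have L1: "(\<lambda>k. LINT v|lborel. real (Suc k) * (\<phi> v - \<phi> (v + h k)) * indicator {s..} v)
      \<longlonglongrightarrow> (LINT v|lborel. dist_fun v * \<phi> v * indicator {s..} v)"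
  proof (rule integral_dominated_convergence[OF _ _ int_exp[of s]])
    show "AE v in lborel. (\<lambda>k. real (Suc k) * (\<phi> v - \<phi> (v + h k)) * indicator {s..} v) \<longlonglongrightarrow> dist_fun v * \<phi> v * indicator {s..} v"
      by (intro AE_I2 tendsto_mult_right lim)
    show "AE v in lborel. norm (real (Suc k) * (\<phi> v - \<phi> (v + h k)) * indicator {s..} v) \<le> exp (- v) * indicator {s..} v" for k
      using bd by (intro AE_I2) (auto simp: indicator_def abs_of_nonneg simp del: of_nat_Suc)
  qed measurable
  \<comment> \<open>Translation invariance telescopes the integral of the quotient to the average of
    \<open>\<phi>\<close> over an interval of length \<open>h k\<close> starting at
    \<open>s\<close>.\<close>
  have step: "(LINT v|lborel. real (Suc k) * (\<phi> v - \<phi> (v + h k)) * indicator {s..} v) =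
      real (Suc k) * (LINT v|lborel. \<phi> v * indicator {s..<s + h k} v)" for k
  proof -
    have "(LINT v|lborel. \<phi> (v + h k) * indicator {s..} v) = (LINT v|lborel. \<phi> v * indicator {s + h k..} v)"
      by (subst (2) lborel_integral_real_affine[where c=1 and t="h k"])
         (auto intro!: Bochner_Integration.integral_cong simp: indicator_def add_ac)
    moreover have "(LINT v|lborel. \<phi> v * indicator {s..<s + h k} v) =
       (LINT v|lborel. \<phi> v * indicator {s..} v - \<phi> v * indicator {s + h k..} v)"
      using h(1)[of k] by (intro Bochner_Integration.integral_cong) (auto simp: indicator_def)
    moreover have "(LINT v|lborel. real (Suc k) * (\<phi> v - \<phi> (v + h k)) * indicator {s..} v) =
       (LINT v|lborel. real (Suc k) * (\<phi> v * indicator {s..} v - \<phi> (v + h k) * indicator {s..} v))"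
      by (intro Bochner_Integration.integral_cong) (auto simp: algebra_simps)
    ultimately show ?thesis
      using int int' by simp
  qed
  \<comment> \<open>The average of the decreasing function \<open>\<phi>\<close> lies between its
    values at the two end points, and \<open>\<phi>\<close> is continuous because
    \<open>mean_max\<close> is.\<close>
  have L2: "(\<lambda>k. real (Suc k) * (LINT v|lborel. \<phi> v * indicator {s..<s + h k} v)) \<longlonglongrightarrow> \<phi> s"
  proof (rule tendsto_sandwich)
    have iI: "integrable lborel (\<lambda>v. \<phi> v * indicator {s..<s + h k} v)" for k
      by (rule Bochner_Integration.integrable_bound[OF int[of s]])
        (use pos in \<open>auto simp: indicator_def less_imp_le\<close>)
    have cI: "integrable lborel (\<lambda>v. c * indicator {s..<s + h k} v :: real)" for k c
      by (auto intro!: integrable_real_indicator simp: h less_imp_le)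
    have cV: "(LINT v|lborel. c * indicator {s..<s + h k} v) = c * h k" for k and c :: real
      using h(1)[of k] by (simp add: measure_def)
    have lo: "\<phi> (s + h k) * h k \<le> (LINT v|lborel. \<phi> v * indicator {s..<s + h k} v)" for k
      unfolding cV[symmetric] by (intro integral_mono cI iI) (auto simp: indicator_def anti)
    have hi: "(LINT v|lborel. \<phi> v * indicator {s..<s + h k} v) \<le> \<phi> s * h k" for k
      unfolding cV[symmetric] by (intro integral_mono cI iI) (auto simp: indicator_def anti)
    have e: "c = real (Suc k) * (c * h k)" for c k
      using h(2)[of k] by (metis mult.left_commute mult.right_neutral)
    show "\<forall>\<^sub>F k in sequentially. \<phi> (s + h k) \<le> real (Suc k) * (LINT v|lborel. \<phi> v * indicator {s..<s + h k} v)"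
      by (intro always_eventually allI, subst e) (rule mult_left_mono[OF lo], simp)
    show "\<forall>\<^sub>F k in sequentially. real (Suc k) * (LINT v|lborel. \<phi> v * indicator {s..<s + h k} v) \<le> \<phi> s"
      by (intro always_eventually allI, subst (2) e) (rule mult_left_mono[OF hi], simp)
    have "(\<lambda>k. mean_max (s + h k)) \<longlonglongrightarrow> mean_max s"
    proof (rule tendsto_sandwich[where h="\<lambda>k. mean_max s + h k" and f="\<lambda>_. mean_max s"])
      show "(\<lambda>k. mean_max s + h k) \<longlonglongrightarrow> mean_max s" using tendsto_add[OF tendsto_const h0, of "mean_max s"] by simp
    qed (use d0[of s] d1[of s] in \<open>auto simp: algebra_simps\<close>)
    then show "(\<lambda>k. \<phi> (s + h k)) \<longlonglongrightarrow> \<phi> s" unfolding \<phi>_def by (intro tendsto_intros)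
  qed simp
  have "(LINT v|lborel. dist_fun v * \<phi> v * indicator {s..} v) = \<phi> s"
    using LIMSEQ_unique[OF L1] L2 unfolding step by blast
  moreover have "integrable lborel (\<lambda>v. dist_fun v * \<phi> v * indicator {s..} v)"
    by (rule Bochner_Integration.integrable_bound[OF int[of s]])
      (use pos dist_fun_nonneg dist_fun_le_1 in \<open>auto simp: indicator_def less_imp_le abs_mult intro!: mult_left_le_one_le\<close>)
  ultimately have "(\<integral>\<^sup>+v. ennreal (dist_fun v * \<phi> v * indicator {s..} v) \<partial>lborel) = ennreal (\<phi> s)"
    using pos dist_fun_nonneg by (subst nn_integral_eq_integral) (auto simp: less_imp_le)
  then show ?thesis
    unfolding \<phi>_def by (simp add: ennreal_mult'' ennreal_indicator)
qed


lemma void_prob_nonneg: "0 \<le> void_prob s" by (simp add: void_prob_def)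

lemma void_prob_le_1: "void_prob s \<le> 1" using mean_max_ge[of s] by (simp add: void_prob_def)

lemma measurable_void_prob [measurable]: "void_prob \<in> borel_measurable borel"
  unfolding void_prob_def[abs_def] by measurable

text \<open>E (W - n)^+ tends to 0 along the integers by dominated convergence with
  \<open>\<bar>W\<bar>\<close>. Slope at most 1 of \<open>mean_max\<close> makes
  \<open>void_prob\<close> nondecreasing, which extends the limit to real arguments.\<close>

lemma void_prob_tendsto_1: "(void_prob \<longlongrightarrow> 1) at_top"
proof -
  have "(\<lambda>n. LINT \<omega>|N. max (real n) (W \<omega>) - real n) \<longlonglongrightarrow> (LINT \<omega>|N. 0)"
  proof (rule integral_dominated_convergence[where w="\<lambda>\<omega>. \<bar>W \<omega>\<bar>"])
    show "AE \<omega> in N. (\<lambda>n. max (real n) (W \<omega>) - real n) \<longlonglongrightarrow> 0"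
    proof (rule AE_I2)
      fix \<omega>
      have "\<forall>\<^sub>F n in sequentially. W \<omega> \<le> real n"
        using filterlim_real_sequentially by (simp add: filterlim_at_top)
      then have "\<forall>\<^sub>F n in sequentially. max (real n) (W \<omega>) - real n = 0"
        by eventually_elim auto
      then show "(\<lambda>n. max (real n) (W \<omega>) - real n) \<longlonglongrightarrow> 0" by (simp add: tendsto_eventually)
    qed
  qed (use integrable_W in auto)
  then have lim: "(\<lambda>n. mean_max (real n) - real n) \<longlonglongrightarrow> 0"
    unfolding mean_max_def using integrable_max_W by (simp add: N.prob_space)
  show ?thesis
  proof (rule order_tendstoI)
    fix a :: real assume "a < 1"
    have "(\<lambda>n. exp (- (mean_max (real n) - real n))) \<longlonglongrightarrow> exp (- 0)"
      by (intro tendsto_intros lim)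
    then have "\<forall>\<^sub>F n in sequentially. a < exp (- (mean_max (real n) - real n))"
      using \<open>a < 1\<close> by (intro order_tendstoD) auto
    then obtain n where n: "a < exp (- (mean_max (real n) - real n))"
      using eventually_happens by fastforce
    have "a < void_prob s" if "real n \<le> s" for s
    proof -
      have "mean_max s \<le> mean_max (real n) + (s - real n)"
        using mean_max_le[of "s - real n" "real n"] that by simp
      then have "exp (- (mean_max (real n) - real n)) \<le> void_prob s" by (simp add: void_prob_def)
      with n show ?thesis by simp
    qed
    then show "\<forall>\<^sub>F s in at_top. a < void_prob s"
      by (auto simp: eventually_at_top_linorder)
  next
    fix a :: real assume "1 < a"
    then show "\<forall>\<^sub>F s in at_top. void_prob s < a"
      using void_prob_le_1 by (intro always_eventually allI) (meson le_less_trans)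
  qed
qed

text \<open>In the variable \<open>v = s + u\<close> the density of the first arrival is
  \<open>exp (s - v)\<close>, and its \<open>exp (- v)\<close> cancels the \<open>exp v\<close> in
  \<open>void_prob v\<close>. What remains is the integral of
  \<open>integral_dist_fun_exp\<close>.\<close>

lemma void_prob_fixed_point:
  "(\<integral>\<^sup>+u. ennreal (dist_fun (s + u)) * ennreal (void_prob (s + u)) \<partial>unit_exponential) = ennreal (void_prob s)"
proof -
  have "(\<integral>\<^sup>+u. ennreal (dist_fun (s + u)) * ennreal (void_prob (s + u)) \<partial>unit_exponential) =
     (\<integral>\<^sup>+v. ennreal (exp (s - v)) * indicator {s..} v * (ennreal (dist_fun v) * ennreal (void_prob v)) \<partial>lborel)"
    by (rule nn_integral_unit_exponential) measurable
  also have "\<dots> = (\<integral>\<^sup>+v. ennreal (exp s) * (ennreal (dist_fun v * exp (- mean_max v)) * indicator {s..} v) \<partial>lborel)"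
  proof (intro nn_integral_cong)
    fix v
    have "ennreal (exp (s - v)) * (ennreal (dist_fun v) * ennreal (void_prob v)) = ennreal (exp (s - v) * (dist_fun v * void_prob v))"
      by (simp add: ennreal_mult dist_fun_nonneg void_prob_nonneg)
    also have "exp (s - v) * (dist_fun v * void_prob v) = exp s * (dist_fun v * exp (- mean_max v))"
      by (simp add: void_prob_def exp_diff exp_minus field_simps)
    also have "ennreal \<dots> = ennreal (exp s) * ennreal (dist_fun v * exp (- mean_max v))"
      by (simp add: ennreal_mult dist_fun_nonneg)
    finally show "ennreal (exp (s - v)) * indicator {s..} v * (ennreal (dist_fun v) * ennreal (void_prob v)) =
        ennreal (exp s) * (ennreal (dist_fun v * exp (- mean_max v)) * indicator {s..} v)"
      by (auto simp: indicator_def)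
  qed
  also have "\<dots> = ennreal (exp s) * ennreal (exp (- mean_max s))"
    using integral_dist_fun_exp[of s] by (subst nn_integral_cmult) auto
  also have "\<dots> = ennreal (void_prob s)"
    by (simp add: void_prob_def ennreal_mult'[symmetric] exp_diff exp_minus field_simps)
  finally show ?thesis .
qed

text \<open>The recursion is monotone and starts from the constant 1, which lies above its fixed
  point \<open>void_prob\<close>.\<close>

lemma void_prob_le_survival: "ennreal (void_prob s) \<le> survival dist_fun n s"
proof (induction n arbitrary: s)
  case 0
  then show ?case using void_prob_le_1 by (simp add: survival_0)
next
  case (Suc n)
  show ?case
    unfolding survival_Suc[OF measurable_dist_fun] void_prob_fixed_point[of s, symmetric]
    by (intro nn_integral_mono mult_left_mono Suc) simp
qed

text \<open>
  The error term halves at each step because \<open>exp (- U)\<close> has mean \<open>1 / 2\<close> for a unit exponential \<open>U\<close>.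
\<close>

lemma survival_le:
  assumes s0: "\<And>s. s0 \<le> s \<Longrightarrow> 1 - \<epsilon> \<le> void_prob s" and \<epsilon>: "0 \<le> \<epsilon>"
  shows "survival dist_fun n s \<le> ennreal (void_prob s) + ennreal \<epsilon> + ennreal (exp (s0 - s) / 2 ^ n)"
proof (induction n arbitrary: s)
  case 0
  \<comment> \<open>The two error terms cover complementary ranges: from \<open>s0\<close> on,
    \<open>\<epsilon>\<close> is enough; before \<open>s0\<close> the exponential is at least
    1.\<close>
  have "1 \<le> void_prob s + \<epsilon> + exp (s0 - s)"
  proof (cases "s0 \<le> s")
    case True
    from s0[OF this] exp_gt_zero[of "s0 - s"] show ?thesis by linarith
  next
    case False
    then have "1 \<le> exp (s0 - s)" by simp
    with \<epsilon> void_prob_nonneg[of s] show ?thesis by linarith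
  qed
  then have "ennreal 1 \<le> ennreal (void_prob s + \<epsilon> + exp (s0 - s))" by (rule ennreal_leI)
  then show ?case using void_prob_nonneg \<epsilon> by (simp add: survival_0)
next
  case (Suc n)
  interpret X: prob_space unit_exponential by (rule prob_space_unit_exponential)
  have [measurable_cong]: "sets unit_exponential = sets borel" by simp
  have F1: "ennreal (dist_fun v) * x \<le> x" for v x
    using mult_right_mono[of "ennreal (dist_fun v)" 1 x] dist_fun_le_1[of v] by simp
  have "survival dist_fun (Suc n) s \<le>
    (\<integral>\<^sup>+u. ennreal (dist_fun (s + u)) * ennreal (void_prob (s + u)) + (ennreal \<epsilon> + ennreal (exp (s0 - (s + u)) / 2 ^ n)) \<partial>unit_exponential)"
    unfolding survival_Suc[OF measurable_dist_fun]
  proof (intro nn_integral_mono)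
    fix u
    have "ennreal (dist_fun (s + u)) * survival dist_fun n (s + u) \<le>
      ennreal (dist_fun (s + u)) * (ennreal (void_prob (s + u)) + (ennreal \<epsilon> + ennreal (exp (s0 - (s + u)) / 2 ^ n)))"
      using Suc[of "s + u"] by (intro mult_left_mono) (auto simp: add.assoc)
    also have "\<dots> = ennreal (dist_fun (s + u)) * ennreal (void_prob (s + u)) +
        ennreal (dist_fun (s + u)) * (ennreal \<epsilon> + ennreal (exp (s0 - (s + u)) / 2 ^ n))"
      by (rule distrib_left)
    also have "\<dots> \<le> ennreal (dist_fun (s + u)) * ennreal (void_prob (s + u)) + (ennreal \<epsilon> + ennreal (exp (s0 - (s + u)) / 2 ^ n))"
      by (intro add_left_mono F1)
    finally show "ennreal (dist_fun (s + u)) * survival dist_fun n (s + u) \<le>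
      ennreal (dist_fun (s + u)) * ennreal (void_prob (s + u)) + (ennreal \<epsilon> + ennreal (exp (s0 - (s + u)) / 2 ^ n))" .
  qed
  also have "\<dots> = ennreal (void_prob s) + (ennreal \<epsilon> + (\<integral>\<^sup>+u. ennreal (exp (s0 - (s + u)) / 2 ^ n) \<partial>unit_exponential))"
    by (simp add: nn_integral_add void_prob_fixed_point X.emeasure_space_1 del: space_density)
  also have "(\<integral>\<^sup>+u. ennreal (exp (s0 - (s + u)) / 2 ^ n) \<partial>unit_exponential) =
     (\<integral>\<^sup>+v. ennreal (exp (s - v)) * indicator {s..} v * ennreal (exp (s0 - v) / 2 ^ n) \<partial>lborel)"
    by (rule nn_integral_unit_exponential) measurable
  also have "\<dots> = (\<integral>\<^sup>+v. ennreal (exp (s + s0) / 2 ^ n) * (ennreal (exp (- (2 * v))) * indicator {s..} v) \<partial>lborel)"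
  proof (intro nn_integral_cong)
    fix v
    have "exp (s - v) * (exp (s0 - v) / 2 ^ n) = exp (s + s0) / 2 ^ n * exp (- (2 * v))"
      by (simp flip: exp_add)
    then show "ennreal (exp (s - v)) * indicator {s..} v * ennreal (exp (s0 - v) / 2 ^ n) =
        ennreal (exp (s + s0) / 2 ^ n) * (ennreal (exp (- (2 * v))) * indicator {s..} v)"
      by (auto simp: indicator_def simp flip: ennreal_mult)
  qed
  also have "\<dots> = ennreal (exp (s + s0) / 2 ^ n) * ennreal (exp (- (2 * s)) / 2)"
    using nn_integral_exp_atLeast[of 2 s] by (subst nn_integral_cmult) auto
  also have "\<dots> = ennreal (exp (s0 - s) / 2 ^ Suc n)"
  proof -
    have "exp (s + s0) / 2 ^ n * (exp (- (2 * s)) / 2) = exp (s0 - s) / 2 ^ Suc n"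
      by (simp flip: exp_add)
    then show ?thesis by (simp flip: ennreal_mult)
  qed
  finally show ?case by (simp add: add.assoc)
qed

lemma survival_tendsto: "(\<lambda>n. survival dist_fun n s) \<longlonglongrightarrow> ennreal (void_prob s)"
proof (rule order_tendstoI)
  fix a assume "a < ennreal (void_prob s)"
  then show "\<forall>\<^sub>F n in sequentially. a < survival dist_fun n s"
    using void_prob_le_survival by (intro always_eventually allI) (meson less_le_trans)
next
  fix a assume a: "ennreal (void_prob s) < a"
  then obtain b where b: "ennreal (void_prob s) < b" "b < a" using dense by blast
  define r where "r = enn2real b"
  have br: "b = ennreal r" using b unfolding r_def by (metis ennreal_enn2real infinity_ennreal_def not_less_iff_gr_or_eq order_less_le_trans top_greatest)
  have r: "void_prob s < r" using b(1) void_prob_nonneg[of s] unfolding br by (simp add: ennreal_less_iff)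
  \<comment> \<open>One half of the gap is for the constant error, the other half for the
    geometrically decaying one.\<close>
  define \<epsilon> where "\<epsilon> = (r - void_prob s) / 2"
  have \<epsilon>: "0 < \<epsilon>" using r by (simp add: \<epsilon>_def)
  have "\<forall>\<^sub>F s in at_top. 1 - \<epsilon> < void_prob s"
    using \<epsilon> by (intro order_tendstoD[OF void_prob_tendsto_1]) auto
  then obtain s0 where s0: "\<And>s. s0 \<le> s \<Longrightarrow> 1 - \<epsilon> \<le> void_prob s"
    by (auto simp: eventually_at_top_linorder dest: less_imp_le)
  have "(\<lambda>n. exp (s0 - s) / 2 ^ n) \<longlonglongrightarrow> 0"
    by real_asymp
  then have "\<forall>\<^sub>F n in sequentially. exp (s0 - s) / 2 ^ n < \<epsilon>"
    using \<epsilon> by (rule order_tendstoD)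
  then show "\<forall>\<^sub>F n in sequentially. survival dist_fun n s < a"
  proof eventually_elim
    case (elim n)
    have "survival dist_fun n s \<le> ennreal (void_prob s) + ennreal \<epsilon> + ennreal (exp (s0 - s) / 2 ^ n)"
      using s0 \<epsilon> by (intro survival_le) auto
    also have "\<dots> = ennreal (void_prob s + \<epsilon> + exp (s0 - s) / 2 ^ n)"
      using void_prob_nonneg[of s] \<epsilon> by (simp add: ennreal_plus)
    also have "\<dots> \<le> ennreal r"
      using elim unfolding \<epsilon>_def by (intro ennreal_leI) (simp add: field_simps)
    finally show ?case using b(2) unfolding br by simp
  qed
qed

end

section \<open>Independent arrivals and marks\<close>

lemma (in prob_space) distr_independent_elements:
  assumes "independent_elements M S U T V"
  shows "distr M (S \<Otimes>\<^sub>M T) (\<lambda>\<omega>. (U \<omega>, V \<omega>)) = distr M S U \<Otimes>\<^sub>M distr M T V"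
proof (rule sym, rule pair_measure_eqI)
  have [measurable]: "U \<in> measurable M S" "V \<in> measurable M T"
    and ind: "indep_set {U -` A \<inter> space M |A. A \<in> sets S} {V -` B \<inter> space M |B. B \<in> sets T}"
    using assms by (auto simp: independent_elements_def)
  show "sigma_finite_measure (distr M S U)" "sigma_finite_measure (distr M T V)"
    by (auto intro!: prob_space_imp_sigma_finite prob_space_distr)
  fix A B assume AB: "A \<in> sets (distr M S U)" "B \<in> sets (distr M T V)"
  then have [measurable]: "A \<in> sets S" "B \<in> sets T" by simp_all
  have "prob ((U -` A \<inter> space M) \<inter> (V -` B \<inter> space M)) = prob (U -` A \<inter> space M) * prob (V -` B \<inter> space M)"
    by (rule indep_setD[OF ind]) auto
  moreover have "(\<lambda>\<omega>. (U \<omega>, V \<omega>)) -` (A \<times> B) \<inter> space M = (U -` A \<inter> space M) \<inter> (V -` B \<inter> space M)"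
    by auto
  ultimately show "emeasure (distr M S U) A * emeasure (distr M T V) B =
      emeasure (distr M (S \<Otimes>\<^sub>M T) (\<lambda>\<omega>. (U \<omega>, V \<omega>))) (A \<times> B)"
    by (simp add: emeasure_distr emeasure_eq_measure ennreal_mult)
qed simp

text \<open>
  For i.i.d. marks \<open>Ws m\<close>, the points \<open>(arrival E m, Ws m)\<close> form a Poisson process, and the event says
  that none of them lies in \<open>{(\<gamma>, w). \<gamma> < w}\<close>.
\<close>

theorem poisson_void_probability:
  fixes Ws :: "nat \<Rightarrow> 'q \<Rightarrow> real" and W :: "'b \<Rightarrow> real"
  assumes "prob_space P" and E: "independent_unit_exponentials P E"
    and Ws: "\<And>m. Ws m \<in> borel_measurable P" "prob_space.indep_vars P (\<lambda>_. borel) Ws UNIV"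
    and indep: "independent_elements P (\<Pi>\<^sub>M k\<in>UNIV. borel) (\<lambda>\<omega> k. E k \<omega>) (\<Pi>\<^sub>M m\<in>UNIV. borel) (\<lambda>\<omega> m. Ws m \<omega>)"
    and N: "prob_space N" "integrable N W"
    and law: "\<And>m v. measure P {\<omega>\<in>space P. Ws m \<omega> \<le> v} = measure N {\<omega>\<in>space N. W \<omega> \<le> v}"
  shows "measure P {\<omega>\<in>space P. \<forall>m. Ws m \<omega> \<le> arrival E m \<omega>} = exp (- (LINT \<omega>|N. max 0 (W \<omega>)))"
proof -
  interpret P: prob_space P by fact
  note [measurable] = Ws(1)
  interpret W: integrable_variable N W
    using N by (simp add: integrable_variable_def integrable_variable_axioms_def)
  have mE [measurable]: "E k \<in> borel_measurable P" for k
    using E by (auto simp: independent_unit_exponentials_def P.indep_vars_def)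
  have mA [measurable]: "arrival E m \<in> borel_measurable P" for m
    unfolding arrival_def[abs_def] by measurable
  let ?B = "\<Pi>\<^sub>M k\<in>(UNIV::nat set). (borel :: real measure)"
  have mEs [measurable]: "(\<lambda>\<omega> k. E k \<omega>) \<in> measurable P ?B" and mWs [measurable]: "(\<lambda>\<omega> m. Ws m \<omega>) \<in> measurable P ?B"
    by (auto intro!: measurable_PiM_single')
  have LE: "distr P ?B (\<lambda>\<omega> k. E k \<omega>) = (\<Pi>\<^sub>M k\<in>UNIV. unit_exponential)"
  proof -
    have "distr P borel (E k) = unit_exponential" for k
    proof -
      have "distr P lborel (E k) = unit_exponential"
        using E by (auto simp: independent_unit_exponentials_def distributed_def)
      then show ?thesis by (metis distr_cong sets_lborel)
    qed
    then show ?thesis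
      using E P.indep_vars_iff_distr_eq_PiM'[where I=UNIV and X=E and M'="\<lambda>_. borel"]
      by (simp add: independent_unit_exponentials_def restrict_UNIV)
  qed
  define A where "A n = {\<omega>\<in>space P. \<forall>m<n. Ws m \<omega> \<le> arrival E m \<omega>}" for n
  have [measurable]: "A n \<in> sets P" for n unfolding A_def by measurable
  have A: "emeasure P (A n) = survival W.dist_fun n 0" for n
  proof -
    define R where "R = {x \<in> space (?B \<Otimes>\<^sub>M ?B). \<forall>m<n. snd x m \<le> (\<Sum>k\<le>m. fst x k)}"
    have [measurable]: "(\<lambda>x. fst x k) \<in> borel_measurable (?B \<Otimes>\<^sub>M ?B)" "(\<lambda>x. snd x k) \<in> borel_measurable (?B \<Otimes>\<^sub>M ?B)" for k
      by (auto intro: measurable_compose[OF measurable_fst measurable_component_singleton]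
          measurable_compose[OF measurable_snd measurable_component_singleton])
    have R: "R \<in> sets (?B \<Otimes>\<^sub>M ?B)" unfolding R_def by measurable
    interpret LW: prob_space "distr P ?B (\<lambda>\<omega> m. Ws m \<omega>)" by (rule P.prob_space_distr) measurable
    have mP: "(\<lambda>\<omega>. (\<lambda>k. E k \<omega>, \<lambda>m. Ws m \<omega>)) \<in> measurable P (?B \<Otimes>\<^sub>M ?B)" by measurable
    have vim: "(\<lambda>\<omega>. (\<lambda>k. E k \<omega>, \<lambda>m. Ws m \<omega>)) -` R \<inter> space P = A n"
      by (auto simp: A_def R_def space_pair_measure space_PiM arrival_def)
    have "emeasure P (A n) = emeasure (distr P (?B \<Otimes>\<^sub>M ?B) (\<lambda>\<omega>. (\<lambda>k. E k \<omega>, \<lambda>m. Ws m \<omega>))) R"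
      by (simp only: emeasure_distr[OF mP R] vim)
    \<comment> \<open>By independence the marks can be integrated out first, with the gaps
      \<open>e\<close> held fixed. The mark constraints then become independent, and each
      contributes the value of \<open>dist_fun\<close> at its arrival time.\<close>
    also have "\<dots> = (\<integral>\<^sup>+e. emeasure (distr P ?B (\<lambda>\<omega> m. Ws m \<omega>)) (Pair e -` R) \<partial>distr P ?B (\<lambda>\<omega> k. E k \<omega>))"
      unfolding P.distr_independent_elements[OF indep] using R
      by (intro LW.emeasure_pair_measure_alt) (simp cong: sets_pair_measure_cong)
    also have "\<dots> = (\<integral>\<^sup>+e. (\<Prod>m<n. ennreal (W.dist_fun (0 + (\<Sum>k\<le>m. e k)))) \<partial>(\<Pi>\<^sub>M k\<in>UNIV. unit_exponential))"
      unfolding LE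
    proof (intro nn_integral_cong)
      fix e :: "nat \<Rightarrow> real"
      let ?c = "\<lambda>m. \<Sum>k\<le>m. e k"
      have "Pair e -` R = {w \<in> space ?B. \<forall>m<n. w m \<le> ?c m}"
        by (auto simp: R_def space_pair_measure space_PiM)
      then have "emeasure (distr P ?B (\<lambda>\<omega> m. Ws m \<omega>)) (Pair e -` R) = emeasure P {\<omega>\<in>space P. \<forall>m<n. Ws m \<omega> \<le> ?c m}"
        using sets_Pair1[OF R, of e]
        by (subst emeasure_distr) (simp_all add: vimage_def space_PiM Int_def conj_commute)
      also have "measure P {\<omega>\<in>space P. \<forall>m<n. Ws m \<omega> \<le> ?c m} = (\<Prod>m<n. W.dist_fun (?c m))"
      \<comment> \<open>For \<open>n = 0\<close> the intersection over no events would be the whole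
        type instead of \<open>space P\<close>.\<close>
      proof (cases "n = 0")
        case False
        have "measure P (\<Inter>m\<in>{..<n}. Ws m -` {..?c m} \<inter> space P) = (\<Prod>m<n. measure P (Ws m -` {..?c m} \<inter> space P))"
          using False P.indep_vars_subset[OF Ws(2), of "{..<n}"] by (intro P.indep_varsD) auto
        moreover have "(\<Inter>m\<in>{..<n}. Ws m -` {..?c m} \<inter> space P) = {\<omega>\<in>space P. \<forall>m<n. Ws m \<omega> \<le> ?c m}"
          using False by auto
        moreover have "Ws m -` {..?c m} \<inter> space P = {\<omega>\<in>space P. Ws m \<omega> \<le> ?c m}" for m by auto
        ultimately show ?thesis by (simp add: law W.dist_fun_def)
      qed (simp add: P.prob_space)
      then have "emeasure P {\<omega>\<in>space P. \<forall>m<n. Ws m \<omega> \<le> ?c m} = (\<Prod>m<n. ennreal (W.dist_fun (0 + ?c m)))"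
        by (simp add: P.emeasure_eq_measure W.dist_fun_def prod_ennreal)
      finally show "emeasure (distr P ?B (\<lambda>\<omega> m. Ws m \<omega>)) (Pair e -` R) = (\<Prod>m<n. ennreal (W.dist_fun (0 + ?c m)))" .
    qed
    finally show ?thesis unfolding survival_def .
  qed
  have "(\<lambda>n. emeasure P (A n)) \<longlonglongrightarrow> emeasure P (\<Inter>n. A n)"
    by (intro Lim_emeasure_decseq) (auto simp: decseq_def A_def P.emeasure_eq_measure)
  moreover have "(\<Inter>n. A n) = {\<omega>\<in>space P. \<forall>m. Ws m \<omega> \<le> arrival E m \<omega>}"
    by (auto simp: A_def)
  ultimately have "ennreal (measure P {\<omega>\<in>space P. \<forall>m. Ws m \<omega> \<le> arrival E m \<omega>}) = ennreal (exp (0 - (LINT \<omega>|N. max 0 (W \<omega>))))"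
    using W.survival_tendsto[of 0] unfolding A W.void_prob_def W.mean_max_def P.emeasure_eq_measure[symmetric]
    by (auto intro: LIMSEQ_unique)
  then show ?thesis by simp
qed

section \<open>Expected maxima of log-Gaussian families\<close>

context centered_gaussian_family
begin

text \<open>This is the mark \<open>W\<close> that belongs to finitely many thresholds. A threshold
  is attached to an index and not to a component, so that a component may be bounded more than
  once.\<close>

definition spectral_max :: "'k set \<Rightarrow> ('k \<Rightarrow> real) \<Rightarrow> 'a \<Rightarrow> real" where
  "spectral_max I x \<omega> = (MAX k\<in>I. exp (G k \<omega> - cov k k / 2) / x k)"

lemma measurable_spectral_max [measurable]:
  assumes "finite I"
  shows "spectral_max I x \<in> borel_measurable M"
  unfolding spectral_max_def using assms by (intro borel_measurable_Max) auto

lemma spectral_max_pos: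
  assumes "finite I" "I \<noteq> {}" "\<forall>k\<in>I. 0 < x k"
  shows "0 < spectral_max I x \<omega>"
  unfolding spectral_max_def using assms by (subst Max_gr_iff) auto

lemma integrable_spectral_max:
  assumes "finite I" "I \<noteq> {}" "\<forall>k\<in>I. 0 < x k"
  shows "integrable M (spectral_max I x)"
proof (rule Bochner_Integration.integrable_bound)
  have "integrable M (\<lambda>\<omega>. exp (G k \<omega> - cov k k / 2))" for k
    using nn_integral_exp_component[of k] by (intro integrableI_nonneg) auto
  then show "integrable M (\<lambda>\<omega>. \<Sum>k\<in>I. exp (G k \<omega> - cov k k / 2) / x k)" by auto
  show "AE \<omega> in M. norm (spectral_max I x \<omega>) \<le> norm (\<Sum>k\<in>I. exp (G k \<omega> - cov k k / 2) / x k)"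
  proof (rule AE_I2)
    fix \<omega>
    have nn: "0 \<le> exp (G k \<omega> - cov k k / 2) / x k" if "k \<in> I" for k
      using assms(3) that by (simp add: less_imp_le)
    have "spectral_max I x \<omega> \<le> (\<Sum>k\<in>I. exp (G k \<omega> - cov k k / 2) / x k)"
      unfolding spectral_max_def using assms(1,2) nn by (subst Max_le_iff) (auto intro!: member_le_sum)
    then show "norm (spectral_max I x \<omega>) \<le> norm (\<Sum>k\<in>I. exp (G k \<omega> - cov k k / 2) / x k)"
      using spectral_max_pos[OF assms, of \<omega>] by simp
  qed
qed (use assms in measurable)

lemma expectation_spectral_max_nonneg:
  assumes "finite I" "I \<noteq> {}" "\<forall>k\<in>I. 0 < x k"
  shows "0 \<le> expectation (spectral_max I x)"
  using spectral_max_pos[OF assms] by (intro integral_nonneg_AE AE_I2 less_imp_le)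

lemma expectation_spectral_max:
  assumes "finite I" "I \<noteq> {}" "\<forall>k\<in>I. 0 < x k"
  shows "ennreal (expectation (spectral_max I x)) = (\<integral>\<^sup>+\<omega>. ennreal (spectral_max I x \<omega>) \<partial>M)"
  using integrable_spectral_max[OF assms] spectral_max_pos[OF assms]
  by (intro nn_integral_eq_integral[symmetric]) (auto intro!: less_imp_le)

text \<open>The positive factor \<open>exp (G p \<omega> - cov p p / 2)\<close> can be pulled out of
  the maximum, and what is left depends on differences from index \<open>p\<close> only, as tilting
  requires. Any reference index will do, even one outside \<open>I\<close>.\<close>

lemma expectation_spectral_max_increments:
  assumes I: "finite I" "I \<noteq> {}" "\<forall>k\<in>I. 0 < x k"
  shows "ennreal (expectation (spectral_max I x)) =
    (\<integral>\<^sup>+\<omega>. ennreal (MAX k\<in>I. exp (G k \<omega> - G p \<omega> - variance (\<lambda>\<omega>. G k \<omega> - G p \<omega>) / 2) / x k) \<partial>M)"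
proof -
  define f where "f y = ennreal (MAX k\<in>I. exp (y k) / x k)" for y
  have f: "f \<in> borel_measurable (\<Pi>\<^sub>M k\<in>UNIV. borel)"
    unfolding f_def using I by (intro measurable_compose[OF _ measurable_ennreal] borel_measurable_Max) auto
  have "spectral_max I x \<omega> = exp (G p \<omega> - cov p p / 2) *
      (MAX k\<in>I. exp ((G k \<omega> - cov k k / 2) - (G p \<omega> - cov p p / 2)) / x k)" for \<omega>
  proof -
    have "mono ((*) (exp (G p \<omega> - cov p p / 2)))" by (auto intro!: monoI mult_left_mono)
    from mono_Max_commute[OF this, of "(\<lambda>k. exp ((G k \<omega> - cov k k / 2) - (G p \<omega> - cov p p / 2)) / x k) ` I"]
    show ?thesis using I by (simp add: spectral_max_def image_image flip: exp_add)
  qed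
  then have "ennreal (spectral_max I x \<omega>) = ennreal (exp (G p \<omega> - cov p p / 2)) *
      f (\<lambda>k. (G k \<omega> - cov k k / 2) - (G p \<omega> - cov p p / 2))" for \<omega>
    by (simp add: f_def ennreal_mult')
  then show ?thesis
    unfolding expectation_spectral_max[OF I] using exponential_tilt_increments[OF f, of p] by (simp add: f_def)
qed

text \<open>The maximum is the sum over \<open>p\<close> of the term at \<open>p\<close>, restricted
  to the event that \<open>p\<close> attains it. The events are given by weak inequalities, so a tie
  would be counted twice; the identity holds almost surely because ties are null events.\<close>

lemma expectation_spectral_max_argmax:
  assumes I: "finite I" "I \<noteq> {}" "\<forall>k\<in>I. 0 < x k"
    and ties: "\<And>k l c. k \<in> I \<Longrightarrow> l \<in> I \<Longrightarrow> k \<noteq> l \<Longrightarrow> AE \<omega> in M. G k \<omega> - G l \<omega> \<noteq> c"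
  shows "expectation (spectral_max I x) =
    (\<Sum>p\<in>I. 1 / x p * prob {\<omega>\<in>space M. \<forall>k\<in>I - {p}.
      G k \<omega> - G p \<omega> - 1 / 2 * variance (\<lambda>\<omega>. G k \<omega> - G p \<omega>) \<le> ln (x k / x p)})"
proof -
  define f where "f p y = (indicator {y. \<forall>k\<in>I - {p}. y k \<le> ln (x k / x p)} y :: ennreal)" for p and y :: "'k \<Rightarrow> real"
  have [measurable]: "(\<lambda>y. y k) \<in> borel_measurable (\<Pi>\<^sub>M k\<in>(UNIV::'k set). (borel :: real measure))" for k
    by (rule measurable_component_singleton) simp
  have "{y \<in> space (\<Pi>\<^sub>M k\<in>UNIV. borel). \<forall>k\<in>I - {p}. y k \<le> ln (x k / x p)} \<in> sets (\<Pi>\<^sub>M k\<in>(UNIV::'k set). (borel :: real measure))" for p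
    using finite_Diff[OF I(1)] by measurable
  then have f: "f p \<in> borel_measurable (\<Pi>\<^sub>M k\<in>UNIV. borel)" for p
    unfolding f_def by (simp add: space_PiM)
  define a where "a k \<omega> = G k \<omega> - cov k k / 2" for k \<omega>
  have le_iff: "a k \<omega> - a p \<omega> \<le> ln (x k / x p) \<longleftrightarrow> exp (a k \<omega>) / x k \<le> exp (a p \<omega>) / x p"
    if "k \<in> I" "p \<in> I" for k p \<omega>
  proof -
    have "a k \<omega> - a p \<omega> \<le> ln (x k / x p) \<longleftrightarrow> exp (a k \<omega> - a p \<omega>) \<le> x k / x p"
      using bspec[OF I(3) that(1)] bspec[OF I(3) that(2)] by (metis divide_pos_pos exp_le_cancel_iff exp_ln)
    then show ?thesis using bspec[OF I(3) that(1)] bspec[OF I(3) that(2)] by (simp add: exp_diff field_simps)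
  qed
  \<comment> \<open>The excluded value of the difference is the one at which the terms for
    \<open>k\<close> and \<open>l\<close> coincide.\<close>
  have "AE \<omega> in M. \<forall>k\<in>I. \<forall>l\<in>I - {k}. G k \<omega> - G l \<omega> \<noteq> ln (x k / x l) + cov k k / 2 - cov l l / 2"
    using I by (auto simp: AE_finite_all intro!: ties)
  then have "AE \<omega> in M. ennreal (spectral_max I x \<omega>) =
      (\<Sum>p\<in>I. ennreal (1 / x p) * (ennreal (exp (G p \<omega> - cov p p / 2)) * f p (\<lambda>k. a k \<omega> - a p \<omega>)))"
  proof eventually_elim
    case (elim \<omega>)
    have ne: "exp (a k \<omega>) / x k \<noteq> exp (a l \<omega>) / x l" if "k \<in> I" "l \<in> I" "k \<noteq> l" for k l
    proof
      assume "exp (a k \<omega>) / x k = exp (a l \<omega>) / x l"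
      then have "a k \<omega> - a l \<omega> \<le> ln (x k / x l)" "a l \<omega> - a k \<omega> \<le> ln (x l / x k)"
        using that le_iff by auto
      moreover have "ln (x l / x k) = - ln (x k / x l)"
        using bspec[OF I(3) that(1)] bspec[OF I(3) that(2)] by (simp add: ln_div)
      ultimately have "a k \<omega> - a l \<omega> = ln (x k / x l)" by linarith
      then show False using elim that unfolding a_def by force
    qed
    have "spectral_max I x \<omega> \<in> (\<lambda>k. exp (a k \<omega>) / x k) ` I"
      unfolding spectral_max_def a_def using I by (intro Max_in) auto
    then obtain p where p: "p \<in> I" "spectral_max I x \<omega> = exp (a p \<omega>) / x p" by auto
    have le: "exp (a k \<omega>) / x k \<le> exp (a p \<omega>) / x p" if "k \<in> I" for k
      unfolding p(2)[symmetric] unfolding spectral_max_def a_def using I that by (intro Max_ge) auto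
    have fp: "f p (\<lambda>k. a k \<omega> - a p \<omega>) = 1"
      using le le_iff p(1) by (auto simp: f_def indicator_def)
    have fq: "f q (\<lambda>k. a k \<omega> - a q \<omega>) = 0" if "q \<in> I - {p}" for q
    proof -
      have "\<not> exp (a p \<omega>) / x p \<le> exp (a q \<omega>) / x q"
        using le[of q] ne[of p q] that p(1) by auto
      then show ?thesis using le_iff[of p q] that p(1) by (auto simp: f_def indicator_def)
    qed
    have "(\<Sum>q\<in>I. ennreal (1 / x q) * (ennreal (exp (a q \<omega>)) * f q (\<lambda>k. a k \<omega> - a q \<omega>))) =
       (\<Sum>q\<in>{p}. ennreal (1 / x q) * (ennreal (exp (a q \<omega>)) * f q (\<lambda>k. a k \<omega> - a q \<omega>)))"
      using I(1) p(1) fq by (intro sum.mono_neutral_right) auto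
    also have "\<dots> = ennreal (spectral_max I x \<omega>)"
      using bspec[OF I(3) p(1)] by (simp add: fp p(2) ennreal_mult'[symmetric])
    finally show ?case by (simp add: a_def)
  qed
  then have "ennreal (expectation (spectral_max I x)) =
      (\<integral>\<^sup>+\<omega>. (\<Sum>p\<in>I. ennreal (1 / x p) * (ennreal (exp (G p \<omega> - cov p p / 2)) * f p (\<lambda>k. a k \<omega> - a p \<omega>))) \<partial>M)"
    unfolding expectation_spectral_max[OF I] by (rule nn_integral_cong_AE)
  also have "\<dots> = (\<Sum>p\<in>I. ennreal (1 / x p) * (\<integral>\<^sup>+\<omega>. ennreal (exp (G p \<omega> - cov p p / 2)) * f p (\<lambda>k. a k \<omega> - a p \<omega>) \<partial>M))"
  proof -
    have [measurable]: "(\<lambda>\<omega>. f p (\<lambda>k. a k \<omega> - a p \<omega>)) \<in> borel_measurable M" for p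
      by (rule measurable_process_function[OF _ f]) (simp add: a_def)
    show ?thesis by (subst nn_integral_sum) (auto simp: nn_integral_cmult)
  qed
  also have "\<dots> = (\<Sum>p\<in>I. ennreal (1 / x p * prob {\<omega>\<in>space M. \<forall>k\<in>I - {p}.
      G k \<omega> - G p \<omega> - 1 / 2 * variance (\<lambda>\<omega>. G k \<omega> - G p \<omega>) \<le> ln (x k / x p)}))"
  proof (rule sum.cong[OF refl])
    fix p assume p: "p \<in> I"
    let ?A = "{\<omega>\<in>space M. \<forall>k\<in>I - {p}. G k \<omega> - G p \<omega> - 1 / 2 * variance (\<lambda>\<omega>. G k \<omega> - G p \<omega>) \<le> ln (x k / x p)}"
    have "(\<integral>\<^sup>+\<omega>. ennreal (exp (G p \<omega> - cov p p / 2)) * f p (\<lambda>k. a k \<omega> - a p \<omega>) \<partial>M) =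
      (\<integral>\<^sup>+\<omega>. f p (\<lambda>k. G k \<omega> - G p \<omega> - variance (\<lambda>\<omega>. G k \<omega> - G p \<omega>) / 2) \<partial>M)"
      unfolding a_def by (rule exponential_tilt_increments[OF f])
    also have "\<dots> = (\<integral>\<^sup>+\<omega>. indicator ?A \<omega> \<partial>M)"
      by (intro nn_integral_cong) (auto simp: f_def indicator_def)
    also have "\<dots> = emeasure M ?A"
      using I by (intro nn_integral_indicator) measurable
    finally have "(\<integral>\<^sup>+\<omega>. ennreal (exp (G p \<omega> - cov p p / 2)) * f p (\<lambda>k. a k \<omega> - a p \<omega>) \<partial>M) = ennreal (prob ?A)"
      by (simp only: emeasure_eq_measure)
    then show "ennreal (1 / x p) * (\<integral>\<^sup>+\<omega>. ennreal (exp (G p \<omega> - cov p p / 2)) * f p (\<lambda>k. a k \<omega> - a p \<omega>) \<partial>M) =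
        ennreal (1 / x p * prob ?A)"
      using bspec[OF I(3) p] by (simp only: ennreal_mult[symmetric] measure_nonneg zero_le_divide_1_iff less_imp_le)
  qed
  also have "\<dots> = ennreal (\<Sum>p\<in>I. 1 / x p * prob {\<omega>\<in>space M. \<forall>k\<in>I - {p}.
      G k \<omega> - G p \<omega> - 1 / 2 * variance (\<lambda>\<omega>. G k \<omega> - G p \<omega>) \<le> ln (x k / x p)})"
    using I(3) by (intro sum_ennreal) (simp add: less_imp_le)
  finally show ?thesis
    using I(3) by (subst (asm) ennreal_inj)
      (auto intro!: sum_nonneg expectation_spectral_max_nonneg[OF I] simp: less_imp_le)
qed

end

text \<open>With a common reference index \<open>p\<close>, both expectations integrate the same
  function of the increments: the variances inside it agree by hypothesis, and so do the laws of the
  increments.\<close>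

lemma expectation_spectral_max_eq:
  assumes "centered_gaussian_family M G" "centered_gaussian_family M' G'"
    and var: "\<And>k l. prob_space.variance M (\<lambda>\<omega>. G k \<omega> - G l \<omega>) = prob_space.variance M' (\<lambda>\<omega>. G' k \<omega> - G' l \<omega>)"
    and I: "finite I" "I \<noteq> {}" "\<forall>k\<in>I. 0 < x k"
  shows "(LINT \<omega>|M. centered_gaussian_family.spectral_max M G I x \<omega>) =
    (LINT \<omega>|M'. centered_gaussian_family.spectral_max M' G' I x \<omega>)"
proof -
  interpret G: centered_gaussian_family M G by fact
  interpret G': centered_gaussian_family M' G' by fact
  obtain p where "p \<in> I" using I by auto
  define f where "f y = ennreal (MAX k\<in>I. exp (y k - G.variance (\<lambda>\<omega>. G k \<omega> - G p \<omega>) / 2) / x k)" for y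
  have f: "f \<in> borel_measurable (\<Pi>\<^sub>M k\<in>UNIV. borel)"
    unfolding f_def using I by (intro measurable_compose[OF _ measurable_ennreal] borel_measurable_Max) auto
  have "ennreal (LINT \<omega>|M. G.spectral_max I x \<omega>) = (\<integral>\<^sup>+\<omega>. f (\<lambda>k. G k \<omega> - G p \<omega>) \<partial>M)"
    using G.expectation_spectral_max_increments[OF I, of p] by (simp add: f_def)
  also have "\<dots> = (\<integral>\<^sup>+y. f y \<partial>process_law M (\<lambda>k \<omega>. G k \<omega> - G p \<omega>))"
    by (rule nn_integral_process_law[OF _ f, symmetric]) simp
  also have "\<dots> = (\<integral>\<^sup>+y. f y \<partial>process_law M' (\<lambda>k \<omega>. G' k \<omega> - G' p \<omega>))"
    using increments_law_eq[OF assms(1-3), of p] by simp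
  also have "\<dots> = (\<integral>\<^sup>+\<omega>. f (\<lambda>k. G' k \<omega> - G' p \<omega>) \<partial>M')"
    by (rule nn_integral_process_law[OF _ f]) simp
  also have "\<dots> = ennreal (LINT \<omega>|M'. G'.spectral_max I x \<omega>)"
    using G'.expectation_spectral_max_increments[OF I, of p] by (simp add: f_def var)
  finally show ?thesis
    by (subst (asm) ennreal_inj)
      (simp_all only: G.expectation_spectral_max_nonneg[OF I] G'.expectation_spectral_max_nonneg[OF I])
qed

section \<open>Brown-Resnick processes\<close>

lemma borel_measurable_vec_nth [measurable (raw)]:
  fixes f :: "'a \<Rightarrow> real ^ 'd"
  shows "f \<in> borel_measurable M \<Longrightarrow> (\<lambda>x. f x $ i) \<in> borel_measurable M"
  by (rule measurable_compose[OF _ borel_measurable_nth])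

text \<open>Joint Gaussianity of the process is expressed by double sums over times and components.
  Repeated list entries are collected into one coefficient per pair.\<close>

lemma lincomb_components_eq_sum:
  fixes Y :: "'t \<Rightarrow> 'b \<Rightarrow> real ^ 'd"
  assumes "finite S" "fst ` fst ` set l \<subseteq> S"
  shows "lincomb (\<lambda>(t, i) \<omega>. Y t \<omega> $ i) l \<omega> =
    (\<Sum>t\<in>S. \<Sum>i\<in>UNIV. (\<Sum>(k, c)\<leftarrow>l. if k = (t, i) then c else 0) * Y t \<omega> $ i)"
  using assms(2)
proof (induction l)
  case Nil
  then show ?case by simp
next
  case (Cons q l)
  obtain t0 i0 c where q: "q = ((t0, i0), c)" by (metis prod.collapse)
  have "t0 \<in> S" using Cons.prems by (auto simp: q)
  have "(\<Sum>i\<in>UNIV. (if (t0, i0) = (t, i) then c else 0) * Y t \<omega> $ i) = (if t0 = t then c * Y t0 \<omega> $ i0 else 0)" for t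
    by (cases "t0 = t") (simp_all add: if_distrib[where f="\<lambda>x. x * _"] cong: if_cong)
  then have "(\<Sum>t\<in>S. \<Sum>i\<in>UNIV. (if (t0, i0) = (t, i) then c else 0) * Y t \<omega> $ i) = c * Y t0 \<omega> $ i0"
    using \<open>finite S\<close> \<open>t0 \<in> S\<close> by simp
  then show ?case
    using Cons by (simp add: q distrib_right sum.distrib)
qed

lemma centered_gaussian_family_components:
  fixes Y :: "'t \<Rightarrow> 'b \<Rightarrow> real ^ 'd" and \<tau> :: "'k \<Rightarrow> 't" and \<kappa> :: "'k \<Rightarrow> 'd"
  assumes "gaussian_process N Y" "centered N Y"
  shows "centered_gaussian_family N (\<lambda>k \<omega>. Y (\<tau> k) \<omega> $ \<kappa> k)"
proof -
  interpret prob_space N using assms by (simp add: gaussian_process_def stochastic_process_def)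
  show ?thesis
  proof
    fix l :: "('k \<times> real) list"
    define l' where "l' = map (\<lambda>(k, a). ((\<tau> k, \<kappa> k), a)) l"
    have e1: "lincomb (\<lambda>k \<omega>. Y (\<tau> k) \<omega> $ \<kappa> k) l \<omega> = lincomb (\<lambda>(t, i) \<omega>. Y t \<omega> $ i) l' \<omega>" for \<omega>
      unfolding l'_def by (induction l) auto
    have e2: "lincomb (\<lambda>(t, i) \<omega>. Y t \<omega> $ i) l' \<omega> =
       (\<Sum>t\<in>fst ` fst ` set l'. \<Sum>i\<in>UNIV. (\<Sum>(k, c)\<leftarrow>l'. if k = (t, i) then c else 0) * Y t \<omega> $ i)" for \<omega>
      by (rule lincomb_components_eq_sum) simp_all
    have eq: "lincomb (\<lambda>k \<omega>. Y (\<tau> k) \<omega> $ \<kappa> k) l =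
       (\<lambda>\<omega>. \<Sum>t\<in>fst ` fst ` set l'. \<Sum>i\<in>UNIV. (\<Sum>(k, c)\<leftarrow>l'. if k = (t, i) then c else 0) * Y t \<omega> $ i)"
      by (rule ext) (rule trans[OF e1 e2])
    have "gaussian_rv N (\<lambda>\<omega>. \<Sum>t\<in>S. \<Sum>i\<in>UNIV. a t i * Y t \<omega> $ i)" if "finite S" for S a
      using assms(1) that by (simp add: gaussian_process_def)
    from this[of "fst ` fst ` set l'" "\<lambda>t i. \<Sum>(k, c)\<leftarrow>l'. if k = (t, i) then c else 0"]
    show "gaussian_rv N (lincomb (\<lambda>k \<omega>. Y (\<tau> k) \<omega> $ \<kappa> k) l)"
      unfolding eq by (simp only: finite_imageI finite_set simp_thms)
  next
    show "expectation (\<lambda>\<omega>. Y (\<tau> k) \<omega> $ \<kappa> k) = 0" for k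
      using assms(2) by (simp add: centered_def)
  qed
qed

text \<open>Needed to move arrival times across inequalities: only for positive arrivals does a
  bound on \<open>inverse (arrival E m \<omega>) * z\<close> turn into a lower bound on the
  arrival.\<close>

lemma unit_exponentials_pos:
  assumes "prob_space P" "independent_unit_exponentials P E"
  shows "AE \<omega> in P. \<forall>m. 0 < E m \<omega>"
proof -
  have "AE \<omega> in P. 0 < E m \<omega>" for m
  proof -
    have d: "distributed P lborel (E m) (\<lambda>v. ennreal (exponential_density 1 v))"
      using assms by (simp add: independent_unit_exponentials_def)
    have "AE v in density lborel (\<lambda>v. ennreal (exponential_density 1 v)). 0 < v"
      using AE_lborel_singleton[of "0::real"]
      by (subst AE_density) (auto simp: exponential_density_def elim!: eventually_mono)
    moreover have "distr P lborel (E m) = density lborel (\<lambda>v. ennreal (exponential_density 1 v))"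
      using d by (simp add: distributed_def)
    ultimately have "AE v in distr P lborel (E m). 0 < v" by (simp only:)
    then show ?thesis
      by (rule AE_distrD[rotated]) (use d in \<open>simp add: distributed_def\<close>)
  qed
  then show ?thesis by (simp add: AE_all_countable)
qed

text \<open>Every preimage under the composition is a preimage under \<open>V\<close>, so
  independence passes to a smaller family of events.\<close>

lemma independent_elements_compose:
  assumes "prob_space P" "independent_elements P S U T V" and h: "h \<in> measurable T T'"
  shows "independent_elements P S U T' (\<lambda>\<omega>. h (V \<omega>))"
proof -
  interpret prob_space P by fact
  have V: "V \<in> measurable P T"
    and ind: "indep_set {U -` A \<inter> space P |A. A \<in> sets S} {V -` B \<inter> space P |B. B \<in> sets T}"
    using assms by (auto simp: independent_elements_def)
  have "{(\<lambda>\<omega>. h (V \<omega>)) -` B \<inter> space P |B. B \<in> sets T'} \<subseteq> {V -` B \<inter> space P |B. B \<in> sets T}"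
  proof clarify
    fix B assume "B \<in> sets T'"
    then have "h -` B \<inter> space T \<in> sets T" using h by (rule measurable_sets[rotated])
    moreover have "(\<lambda>\<omega>. h (V \<omega>)) -` B \<inter> space P = V -` (h -` B \<inter> space T) \<inter> space P"
      using measurable_space[OF V] by auto
    ultimately show "\<exists>B'. (\<lambda>\<omega>. h (V \<omega>)) -` B \<inter> space P = V -` B' \<inter> space P \<and> B' \<in> sets T" by blast
  qed
  moreover have "indep_set A B'" if "indep_set A B" "B' \<subseteq> B" for A B B'
    using that unfolding indep_sets2_eq by (meson subsetD order_trans)
  ultimately have "indep_set {U -` A \<inter> space P |A. A \<in> sets S} {(\<lambda>\<omega>. h (V \<omega>)) -` B \<inter> space P |B. B \<in> sets T'}"
    using ind by blast
  then show ?thesis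
    using assms(2) measurable_compose[OF V h] by (simp add: independent_elements_def)
qed

text \<open>The supremum stays below all thresholds iff each single point does, and a point at
  \<open>\<gamma>\<close> with path \<open>z\<close> does iff the largest ratio \<open>z / x\<close>
  is at most \<open>\<gamma>\<close>. All thresholds are thus merged into one scalar mark, to which
  the void probability applies.\<close>

theorem brown_resnick_cdf:
  fixes X :: "real ^ 'p \<Rightarrow> 'a \<Rightarrow> real ^ 'd" and Y :: "real ^ 'p \<Rightarrow> 'b \<Rightarrow> real ^ 'd"
    and \<tau> :: "'k \<Rightarrow> real ^ 'p" and \<kappa> :: "'k \<Rightarrow> 'd"
  assumes br: "brown_resnick M X N Y P E Zs"
    and I: "finite I" "I \<noteq> {}" "\<forall>k\<in>I. 0 < x k"
  shows "measure M {\<omega>\<in>space M. \<forall>k\<in>I. X (\<tau> k) \<omega> $ \<kappa> k \<le> x k} =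
    exp (- (LINT \<omega>|N. centered_gaussian_family.spectral_max N (\<lambda>k \<omega>. Y (\<tau> k) \<omega> $ \<kappa> k) I x \<omega>))"
proof -
  define Z where "Z = brown_resnick_spectral N Y"
  have gauss: "gaussian_process N Y" "centered N Y" and sp: "spectral_process M X N Z P E Zs"
    using br by (auto simp: brown_resnick_def Z_def)
  interpret G: centered_gaussian_family N "\<lambda>k \<omega>. Y (\<tau> k) \<omega> $ \<kappa> k"
    using gauss by (rule centered_gaussian_family_components)
  have X [measurable]: "X t \<in> borel_measurable M" and "prob_space M"
    and Z [measurable]: "Z t \<in> borel_measurable N"
    and "prob_space P" and E: "independent_unit_exponentials P E"
    and copies: "independent_copies P Zs N Z"
    and ind: "independent_elements P (\<Pi>\<^sub>M k\<in>UNIV. borel) (\<lambda>\<omega> k. E k \<omega>)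
       (\<Pi>\<^sub>M m\<in>UNIV. \<Pi>\<^sub>M t\<in>UNIV. borel) (\<lambda>\<omega> m t. Zs m t \<omega>)"
    and law: "process_law M (\<lambda>(t, i) \<omega>. ereal (X t \<omega> $ i)) =
     process_law P (\<lambda>(t, i) \<omega>. SUP m. ereal (inverse (arrival E m \<omega>) * Zs m t \<omega> $ i))" for t
    using sp by (auto simp: spectral_process_def stochastic_process_def)
  interpret M: prob_space M by fact
  interpret P: prob_space P by fact
  have Zs [measurable]: "Zs m t \<in> borel_measurable P" and Zs_law: "process_law P (Zs m) = process_law N Z"
    and Zs_indep: "P.indep_vars (\<lambda>_. \<Pi>\<^sub>M t\<in>UNIV. borel) (\<lambda>m \<omega> t. Zs m t \<omega>) UNIV" for m t
    using copies by (auto simp: independent_copies_def stochastic_process_def)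
  have mE [measurable]: "E k \<in> borel_measurable P" for k
    using E by (auto simp: independent_unit_exponentials_def P.indep_vars_def)
  have mA [measurable]: "arrival E m \<in> borel_measurable P" for m
    unfolding arrival_def[abs_def] by measurable
  \<comment> \<open>As a functional of the whole path, \<open>h\<close> transports law and
    independence from the copies \<open>Zs\<close> to the marks.\<close>
  define h where "h z = (MAX k\<in>I. z (\<tau> k) $ \<kappa> k / x k)" for z :: "real ^ 'p \<Rightarrow> real ^ 'd"
  have h: "h \<in> borel_measurable (\<Pi>\<^sub>M t\<in>UNIV. borel)"
  proof -
    have [measurable]: "(\<lambda>z. z (\<tau> k)) \<in> borel_measurable (\<Pi>\<^sub>M t\<in>UNIV. (borel :: (real ^ 'd) measure))" for k
      by (rule measurable_component_singleton) simp
    have "(\<lambda>z. z (\<tau> k) $ \<kappa> k / x k) \<in> borel_measurable (\<Pi>\<^sub>M t\<in>UNIV. (borel :: (real ^ 'd) measure))" for k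
      by (intro borel_measurable_divide borel_measurable_const measurable_compose[OF _ borel_measurable_nth]
          measurable_component_singleton) simp
    then show ?thesis unfolding h_def using I(1) by (intro borel_measurable_Max)
  qed
  have h_le: "h z \<le> v \<longleftrightarrow> (\<forall>k\<in>I. z (\<tau> k) $ \<kappa> k / x k \<le> v)" for z v
    unfolding h_def using I by (subst Max_le_iff) auto
  have hZ: "h (\<lambda>t. Z t \<omega>) = G.spectral_max I x \<omega>" for \<omega>
    unfolding h_def G.spectral_max_def Z_def brown_resnick_spectral_def G.variance_component[symmetric] by simp
  have void: "measure P {\<omega>\<in>space P. \<forall>m. h (\<lambda>t. Zs m t \<omega>) \<le> arrival E m \<omega>} =
      exp (- (LINT \<omega>|N. max 0 (G.spectral_max I x \<omega>)))"
  proof (rule poisson_void_probability[OF \<open>prob_space P\<close> E])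
    show "(\<lambda>\<omega>. h (\<lambda>t. Zs m t \<omega>)) \<in> borel_measurable P" for m
      by (rule measurable_compose[OF _ h]) (auto intro!: measurable_PiM_single')
    show "P.indep_vars (\<lambda>_. borel) (\<lambda>m \<omega>. h (\<lambda>t. Zs m t \<omega>)) UNIV"
      using P.indep_vars_compose2[OF Zs_indep, of "\<lambda>_. h" "\<lambda>_. borel"] h by simp
    show "independent_elements P (\<Pi>\<^sub>M k\<in>UNIV. borel) (\<lambda>\<omega> k. E k \<omega>) (\<Pi>\<^sub>M m\<in>UNIV. borel) (\<lambda>\<omega> m. h (\<lambda>t. Zs m t \<omega>))"
    proof (rule independent_elements_compose[OF \<open>prob_space P\<close> ind, of "\<lambda>z m. h (z m)"])
      show "(\<lambda>z m. h (z m)) \<in> measurable (\<Pi>\<^sub>M m\<in>UNIV. \<Pi>\<^sub>M t\<in>UNIV. borel) (\<Pi>\<^sub>M m\<in>UNIV. borel)"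
        by (intro measurable_PiM_single' measurable_compose[OF _ h] measurable_component_singleton)
          (auto simp: space_PiM)
    qed
    show "prob_space N" by (rule G.prob_space_axioms)
    show "integrable N (G.spectral_max I x)" using I by (rule G.integrable_spectral_max)
    fix m v
    have m: "(\<lambda>\<omega> t. Zs m t \<omega>) \<in> measurable P (\<Pi>\<^sub>M t\<in>UNIV. borel)" "(\<lambda>\<omega> t. Z t \<omega>) \<in> measurable N (\<Pi>\<^sub>M t\<in>UNIV. borel)"
      by (auto intro!: measurable_PiM_single')
    have S: "{z \<in> space (\<Pi>\<^sub>M t\<in>UNIV. borel). h z \<le> v} \<in> sets (\<Pi>\<^sub>M t\<in>UNIV. borel)"
      by (intro borel_measurable_le h borel_measurable_const)
    have "measure P {\<omega>\<in>space P. h (\<lambda>t. Zs m t \<omega>) \<le> v} = measure (process_law P (Zs m)) {z \<in> space (\<Pi>\<^sub>M t\<in>UNIV. borel). h z \<le> v}"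
      unfolding process_law_def by (subst measure_distr[OF m(1) S])
        (auto simp: space_PiM intro!: arg_cong[where f="measure P"])
    also have "\<dots> = measure N {\<omega>\<in>space N. h (\<lambda>t. Z t \<omega>) \<le> v}"
      unfolding Zs_law unfolding process_law_def by (subst measure_distr[OF m(2) S])
        (auto simp: space_PiM intro!: arg_cong[where f="measure N"])
    finally show "measure P {\<omega>\<in>space P. h (\<lambda>t. Zs m t \<omega>) \<le> v} = measure N {\<omega>\<in>space N. G.spectral_max I x \<omega> \<le> v}"
      unfolding hZ .
  qed
  let ?B = "\<Pi>\<^sub>M q\<in>(UNIV :: ((real ^ 'p) \<times> 'd) set). (borel :: ereal measure)"
  let ?S = "\<lambda>\<omega>. \<lambda>(t, i). SUP m. ereal (inverse (arrival E m \<omega>) * Zs m t \<omega> $ i)"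
  define R where "R = {\<xi> \<in> space ?B. \<forall>k\<in>I. \<xi> (\<tau> k, \<kappa> k) \<le> ereal (x k)}"
  have [measurable]: "(\<lambda>\<xi>. \<xi> q) \<in> borel_measurable ?B" for q
    by (rule measurable_component_singleton) simp
  have R: "R \<in> sets ?B" unfolding R_def using I(1) by measurable
  have mX: "(\<lambda>\<omega> q. (case q of (t, i) \<Rightarrow> \<lambda>\<omega>. ereal (X t \<omega> $ i)) \<omega>) \<in> measurable M ?B"
  proof (rule measurable_PiM_single')
    fix q :: "(real ^ 'p) \<times> 'd"
    obtain t i where "q = (t, i)" by force
    then show "(case q of (t, i) \<Rightarrow> \<lambda>\<omega>. ereal (X t \<omega> $ i)) \<in> borel_measurable M"
      by simp
  qed (simp add: space_PiM)
  have mS: "(\<lambda>\<omega> q. (case q of (t, i) \<Rightarrow> \<lambda>\<omega>. SUP m. ereal (inverse (arrival E m \<omega>) * Zs m t \<omega> $ i)) \<omega>) \<in> measurable P ?B"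
  proof (rule measurable_PiM_single')
    fix q :: "(real ^ 'p) \<times> 'd"
    obtain t i where "q = (t, i)" by force
    then show "(case q of (t, i) \<Rightarrow> \<lambda>\<omega>. SUP m. ereal (inverse (arrival E m \<omega>) * Zs m t \<omega> $ i)) \<in> borel_measurable P"
      by simp
  qed (simp add: space_PiM)
  have "measure M {\<omega>\<in>space M. \<forall>k\<in>I. X (\<tau> k) \<omega> $ \<kappa> k \<le> x k} =
      measure (process_law M (\<lambda>(t, i) \<omega>. ereal (X t \<omega> $ i))) R"
    unfolding process_law_def by (subst measure_distr[OF mX R])
      (auto simp: R_def space_PiM intro!: arg_cong[where f="measure M"])
  also have "\<dots> = measure P {\<omega>\<in>space P. \<forall>k\<in>I. (SUP m. ereal (inverse (arrival E m \<omega>) * Zs m (\<tau> k) \<omega> $ \<kappa> k)) \<le> ereal (x k)}"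
    unfolding law unfolding process_law_def by (subst measure_distr[OF mS R])
      (auto simp: R_def space_PiM intro!: arg_cong[where f="measure P"])
  also have "\<dots> = measure P {\<omega>\<in>space P. \<forall>m. h (\<lambda>t. Zs m t \<omega>) \<le> arrival E m \<omega>}"
  proof (rule P.finite_measure_eq_AE)
    have mh: "(\<lambda>\<omega>. h (\<lambda>t. Zs m t \<omega>)) \<in> borel_measurable P" for m
      by (rule measurable_compose[OF _ h]) (auto intro!: measurable_PiM_single')
    show "{\<omega>\<in>space P. \<forall>m. h (\<lambda>t. Zs m t \<omega>) \<le> arrival E m \<omega>} \<in> sets P"
      using mh by measurable
    show "{\<omega>\<in>space P. \<forall>k\<in>I. (SUP m. ereal (inverse (arrival E m \<omega>) * Zs m (\<tau> k) \<omega> $ \<kappa> k)) \<le> ereal (x k)} \<in> sets P"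
      using I(1) by measurable
    show "AE \<omega> in P. \<omega> \<in> {\<omega>\<in>space P. \<forall>k\<in>I. (SUP m. ereal (inverse (arrival E m \<omega>) * Zs m (\<tau> k) \<omega> $ \<kappa> k)) \<le> ereal (x k)} \<longleftrightarrow>
        \<omega> \<in> {\<omega>\<in>space P. \<forall>m. h (\<lambda>t. Zs m t \<omega>) \<le> arrival E m \<omega>}"
      using unit_exponentials_pos[OF \<open>prob_space P\<close> E]
    proof eventually_elim
      case (elim \<omega>)
      have pos: "0 < arrival E m \<omega>" for m
        unfolding arrival_def using elim by (intro sum_pos) auto
      have "inverse (arrival E m \<omega>) * z \<le> x k \<longleftrightarrow> z / x k \<le> arrival E m \<omega>" if "k \<in> I" for k z m
        using pos[of m] bspec[OF I(3) that] by (simp add: field_simps)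
      then show ?case
        by (auto simp: SUP_le_iff h_le)
    qed
  qed
  \<comment> \<open>The truncation at 0, which comes from starting the arrivals at time 0, has no
    effect on a positive mark.\<close>
  also have "\<dots> = exp (- (LINT \<omega>|N. G.spectral_max I x \<omega>))"
    unfolding void using G.spectral_max_pos[OF I] by (simp add: max_def less_imp_le)
  finally show ?thesis .
qed

text \<open>The normalized log-Gaussian variable has mean 1, so the margins are unit Frechet with
  distribution function exp (- 1 / e), which vanishes as \<open>e\<close> decreases to 0.\<close>

lemma brown_resnick_pos:
  assumes br: "brown_resnick M X N Y P E Zs"
  shows "measure M {\<omega>\<in>space M. X t \<omega> $ i \<le> 0} = 0"
proof -
  interpret M: prob_space M
    using br by (simp add: brown_resnick_def spectral_process_def stochastic_process_def)
  have [measurable]: "X t \<in> borel_measurable M"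
    using br by (simp add: brown_resnick_def spectral_process_def stochastic_process_def)
  interpret G: centered_gaussian_family N "\<lambda>_::unit. \<lambda>\<omega>. Y t \<omega> $ i"
    using br by (intro centered_gaussian_family_components) (auto simp: brown_resnick_def)
  have b: "measure M {\<omega>\<in>space M. X t \<omega> $ i \<le> e} = exp (- (1 / e))" if "0 < e" for e
  proof -
    have "ennreal (LINT \<omega>|N. G.spectral_max {()} (\<lambda>_. e) \<omega>) = ennreal (1 / e)"
      using that G.nn_integral_exp_component[of "()"]
      by (subst G.expectation_spectral_max)
        (auto simp: G.spectral_max_def divide_ennreal[symmetric] nn_integral_divide)
    then have "(LINT \<omega>|N. G.spectral_max {()} (\<lambda>_. e) \<omega>) = 1 / e"
      using that G.expectation_spectral_max_nonneg[of "{()}" "\<lambda>_. e"] by (subst (asm) ennreal_inj) auto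
    then show ?thesis
      using brown_resnick_cdf[OF br, of "{()}" "\<lambda>_. e" "\<lambda>_. t" "\<lambda>_. i"] that by simp
  qed
  have "(\<lambda>n. exp (- real (Suc n))) \<longlonglongrightarrow> 0" by real_asymp
  moreover have "measure M {\<omega>\<in>space M. X t \<omega> $ i \<le> 0} \<le> exp (- real (Suc n))" for n
  proof -
    have "measure M {\<omega>\<in>space M. X t \<omega> $ i \<le> 0} \<le> measure M {\<omega>\<in>space M. X t \<omega> $ i \<le> 1 / real (Suc n)}"
      by (intro M.finite_measure_mono) (auto intro: order_trans)
    then show ?thesis using b[of "1 / real (Suc n)"] by simp
  qed
  ultimately have "measure M {\<omega>\<in>space M. X t \<omega> $ i \<le> 0} \<le> 0"
    by (intro LIMSEQ_le_const) auto
  then show ?thesis by (simp add: measure_le_0_iff)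
qed

section \<open>Equality of laws\<close>

lemma process_law_vec:
  fixes X :: "'t \<Rightarrow> 'a \<Rightarrow> real ^ 'd"
  assumes X [measurable]: "\<And>t. X t \<in> borel_measurable M"
  shows "process_law M X =
    distr (process_law M (\<lambda>k \<omega>. X (fst k) \<omega> $ snd k)) (\<Pi>\<^sub>M t\<in>UNIV. borel) (\<lambda>y t. \<chi> i. y (t, i))"
proof -
  have c: "(\<lambda>y. y k) \<in> borel_measurable (\<Pi>\<^sub>M k\<in>(UNIV :: ('t \<times> 'd) set). (borel :: real measure))" for k
    by (rule measurable_component_singleton) simp
  have "(\<lambda>y. (\<chi> i. y (t, i)) :: real ^ 'd) \<in> borel_measurable (\<Pi>\<^sub>M k\<in>UNIV. borel)" for t :: 't
  proof (subst borel_measurable_euclidean_space, rule ballI)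
    fix b :: "real ^ 'd" assume "b \<in> Basis"
    then obtain i where "b = axis i 1" by (auto simp: Basis_vec_def)
    then show "(\<lambda>y. (\<chi> i. y (t, i)) \<bullet> b) \<in> borel_measurable (\<Pi>\<^sub>M k\<in>UNIV. borel)"
      using c[of "(t, i)"] by (simp add: inner_axis)
  qed
  then have "(\<lambda>y (t :: 't). (\<chi> i. y (t, i)) :: real ^ 'd) \<in> measurable (\<Pi>\<^sub>M k\<in>UNIV. borel) (\<Pi>\<^sub>M t\<in>UNIV. borel)"
    by (intro measurable_PiM_single') (auto simp: space_PiM)
  moreover have "(\<lambda>\<omega> k. X (fst k) \<omega> $ snd k) \<in> measurable M (\<Pi>\<^sub>M k\<in>UNIV. borel)"
    by (intro measurable_PiM_single') auto
  ultimately show ?thesis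
    unfolding process_law_def by (subst distr_distr) (auto simp: comp_def)
qed

text \<open>The time changes \<open>\<sigma>\<close> and \<open>\<sigma>'\<close> let one statement
  serve twice: with identities it compares two processes, and with a translation it compares a
  process with its own shift.\<close>

theorem brown_resnick_law_eq:
  fixes X :: "real ^ 'p \<Rightarrow> 'a \<Rightarrow> real ^ 'd" and X' :: "real ^ 'p \<Rightarrow> 'a2 \<Rightarrow> real ^ 'd"
    and \<sigma> \<sigma>' :: "'t \<Rightarrow> real ^ 'p"
  assumes br: "brown_resnick M X N Y P E Zs" and br': "brown_resnick M' X' N' Y' P' E' Zs'"
    and var: "\<And>i j t s. pseudo_variogram N Y i j (\<sigma> t) (\<sigma> s) = pseudo_variogram N' Y' i j (\<sigma>' t) (\<sigma>' s)"
  shows "process_law M (\<lambda>t. X (\<sigma> t)) = process_law M' (\<lambda>t. X' (\<sigma>' t))"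
proof -
  have M: "prob_space M" and X [measurable]: "X t \<in> borel_measurable M"
    and M': "prob_space M'" and X' [measurable]: "X' t \<in> borel_measurable M'" for t
    using br br' by (simp_all add: brown_resnick_def spectral_process_def stochastic_process_def)
  interpret M: prob_space M by fact
  interpret M': prob_space M' by fact
  have "process_law M (\<lambda>k \<omega>. X (\<sigma> (fst k)) \<omega> $ snd k) = process_law M' (\<lambda>k \<omega>. X' (\<sigma>' (fst k)) \<omega> $ snd k)"
  proof (rule process_law_eqI_cdf[OF M M'])
    fix T :: "(('t \<times> 'd) \<times> real) set" assume T: "finite T"
    show "measure M {\<omega>\<in>space M. \<forall>(k, b)\<in>T. X (\<sigma> (fst k)) \<omega> $ snd k \<le> b} =
      measure M' {\<omega>\<in>space M'. \<forall>(k, b)\<in>T. X' (\<sigma>' (fst k)) \<omega> $ snd k \<le> b}"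
    \<comment> \<open>If some threshold is not positive, both events are null because the components
      are almost surely positive. Otherwise \<open>T\<close> itself serves as index set, with
      \<open>snd\<close> as threshold function.\<close>
    proof (cases "\<forall>q\<in>T. 0 < snd q")
      case True
      show ?thesis
      proof (cases "T = {}")
        case False
        note c = brown_resnick_cdf[OF br T False True, of "\<lambda>q. \<sigma> (fst (fst q))" "\<lambda>q. snd (fst q)"]
        note c' = brown_resnick_cdf[OF br' T False True, of "\<lambda>q. \<sigma>' (fst (fst q))" "\<lambda>q. snd (fst q)"]
        have "(LINT \<omega>|N. centered_gaussian_family.spectral_max N (\<lambda>q \<omega>. Y (\<sigma> (fst (fst q))) \<omega> $ snd (fst q)) T snd \<omega>) =
            (LINT \<omega>|N'. centered_gaussian_family.spectral_max N' (\<lambda>q \<omega>. Y' (\<sigma>' (fst (fst q))) \<omega> $ snd (fst q)) T snd \<omega>)"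
        proof (rule expectation_spectral_max_eq[OF _ _ _ T False True])
          show "centered_gaussian_family N (\<lambda>q \<omega>. Y (\<sigma> (fst (fst q))) \<omega> $ snd (fst q))"
            using br by (intro centered_gaussian_family_components) (auto simp: brown_resnick_def)
          show "centered_gaussian_family N' (\<lambda>q \<omega>. Y' (\<sigma>' (fst (fst q))) \<omega> $ snd (fst q))"
            using br' by (intro centered_gaussian_family_components) (auto simp: brown_resnick_def)
        qed (use var in \<open>simp add: pseudo_variogram_def\<close>)
        then show ?thesis using c c' by (simp add: split_def)
      qed (simp add: M.prob_space M'.prob_space)
    next
      case False
      then obtain k b where kb: "(k, b) \<in> T" "b \<le> 0" by force
      have "measure M {\<omega>\<in>space M. \<forall>(k, b)\<in>T. X (\<sigma> (fst k)) \<omega> $ snd k \<le> b} \<le>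
          measure M {\<omega>\<in>space M. X (\<sigma> (fst k)) \<omega> $ snd k \<le> 0}"
        using kb by (intro M.finite_measure_mono) force+
      moreover have "measure M' {\<omega>\<in>space M'. \<forall>(k, b)\<in>T. X' (\<sigma>' (fst k)) \<omega> $ snd k \<le> b} \<le>
          measure M' {\<omega>\<in>space M'. X' (\<sigma>' (fst k)) \<omega> $ snd k \<le> 0}"
        using kb by (intro M'.finite_measure_mono) force+
      ultimately show ?thesis
        unfolding brown_resnick_pos[OF br] brown_resnick_pos[OF br'] by (simp add: measure_le_0_iff)
    qed
  qed measurable
  then show ?thesis
    using process_law_vec[of "\<lambda>t. X (\<sigma> t)" M] process_law_vec[of "\<lambda>t. X' (\<sigma>' t)" M'] by simp
qed

section \<open>Absence of ties under a density\<close>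

lemma AE_lborel_hyperplane:
  fixes a :: "'v::euclidean_space"
  assumes "a \<noteq> 0"
  shows "AE v in lborel. a \<bullet> v \<noteq> c"
proof -
  have "{v. a \<bullet> v = c} \<in> null_sets lebesgue"
    using negligible_hyperplane[of a c] assms by (simp add: negligible_iff_null_sets)
  then have "{v. a \<bullet> v = c} \<in> null_sets lborel"
    by (simp add: null_sets_completion_iff closed_hyperplane)
  then show ?thesis by (rule AE_I') auto
qed

text \<open>By absolute continuity it suffices that the tie set is null for the product Lebesgue
  measure. With all time blocks except \<open>j\<close> fixed, it is a hyperplane in block
  \<open>j\<close>.\<close>

lemma distributed_component_difference:
  fixes V :: "'b \<Rightarrow> nat \<Rightarrow> real ^ 'd"
  assumes V: "distributed N (\<Pi>\<^sub>M j\<in>J. lborel) V f" and J: "finite J" "j \<in> J" "l \<in> J" and ne: "(i, j) \<noteq> (k, l)"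
  shows "AE \<omega> in N. V \<omega> j $ i - V \<omega> l $ k \<noteq> c"
proof -
  interpret product_sigma_finite "\<lambda>_::nat. lborel :: (real ^ 'd) measure"
    by (rule product_sigma_finite.intro) (rule lborel.sigma_finite_measure_axioms)
  let ?M = "\<lambda>J. \<Pi>\<^sub>M j\<in>(J :: nat set). (lborel :: (real ^ 'd) measure)"
  define J' where "J' = J - {j}"
  have J': "finite J'" "j \<notin> J'" "J = insert j J'" using J by (auto simp: J'_def)
  have [measurable]: "(\<lambda>y. y m $ n) \<in> borel_measurable (?M J)" if "m \<in> J" for m n
    using measurable_compose[OF measurable_component_singleton[OF that] borel_measurable_nth[of n]]
    by simp
  define A where "A = {y \<in> space (?M J). y j $ i - y l $ k = c}"
  have A: "A \<in> sets (?M J)" unfolding A_def using J by measurable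
  have "emeasure (?M J) A = (\<integral>\<^sup>+y. indicator A y \<partial>?M J)" using A by simp
  also have "\<dots> = (\<integral>\<^sup>+y. (\<integral>\<^sup>+v. indicator A (y(j := v)) \<partial>lborel) \<partial>?M J')"
    unfolding J'(3) by (rule product_nn_integral_insert[OF J'(1,2)]) (use A J'(3) in simp)
  also have "\<dots> = (\<integral>\<^sup>+y. 0 \<partial>?M J')"
  proof (rule nn_integral_cong)
    fix y :: "nat \<Rightarrow> real ^ 'd"
    \<comment> \<open>The normal vector of the hyperplane. If both components belong to the same
      block, then \<open>i \<noteq> k\<close> and the two axes do not cancel; otherwise the second
      component is a constant, absorbed into \<open>d\<close>.\<close>
    define a :: "real ^ 'd" where "a = axis i 1 - (if l = j then axis k 1 else 0)"
    define d where "d = c + (if l = j then 0 else y l $ k)"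
    have "a \<noteq> 0"
    proof
      assume "a = 0"
      then have "a $ i = 0" by simp
      then show False using ne by (auto simp: a_def axis_def split: if_splits)
    qed
    moreover have "a \<bullet> v = v $ i - (if l = j then v $ k else 0)" for v
      by (simp add: a_def inner_diff_left inner_axis')
    ultimately have "AE v in lborel. v $ i - (if l = j then v $ k else 0) \<noteq> d"
      using AE_lborel_hyperplane[of a d] by simp
    then have "AE v in lborel. indicator A (y(j := v)) = (0::ennreal)"
      by eventually_elim (auto simp: A_def indicator_def d_def split: if_splits)
    then have "(\<integral>\<^sup>+v. indicator A (y(j := v)) \<partial>lborel) = (\<integral>\<^sup>+v. 0 \<partial>(lborel :: (real ^ 'd) measure))"
      by (rule nn_integral_cong_AE)
    then show "(\<integral>\<^sup>+v. indicator A (y(j := v)) \<partial>lborel) = 0" by simp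
  qed
  finally have "A \<in> null_sets (?M J)" using A by (simp add: null_sets_def)
  then have "AE y in ?M J. y j $ i - y l $ k \<noteq> c" by (rule AE_I') (auto simp: A_def)
  then have "AE y in density (?M J) f. y j $ i - y l $ k \<noteq> c"
    using V by (subst AE_density) (auto simp: distributed_def)
  moreover have "distr N (?M J) V = density (?M J) f" using V by (simp add: distributed_def)
  ultimately have "AE y in distr N (?M J) V. y j $ i - y l $ k \<noteq> c" by (simp only:)
  then show ?thesis
    by (rule AE_distrD[rotated]) (use V in \<open>simp add: distributed_def\<close>)
qed

theorem lemma4p2:
  fixes M :: "'a measure" and X :: "real ^ 'p \<Rightarrow> 'a \<Rightarrow> real ^ 'd"
    and N :: "'b measure" and Y :: "real ^ 'p \<Rightarrow> 'b \<Rightarrow> real ^ 'd"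
    and P :: "'q measure" and E :: "nat \<Rightarrow> 'q \<Rightarrow> real"
    and Zs :: "nat \<Rightarrow> real ^ 'p \<Rightarrow> 'q \<Rightarrow> real ^ 'd"
  assumes "brown_resnick M X N Y P E Zs"
  shows "(\<forall>(M' :: 'a2 measure) X' (N' :: 'b2 measure) Y' (P' :: 'q2 measure) E' Zs'.
           brown_resnick M' X' N' Y' P' E' Zs' \<longrightarrow>
           (\<forall>i j t s. pseudo_variogram N Y i j t s = pseudo_variogram N' Y' i j t s) \<longrightarrow>
           process_law M X = process_law M' X') \<and>
         ((\<exists>g. \<forall>i j t s. pseudo_variogram N Y i j t s = g i j (t - s)) \<longrightarrow> stationary M X) \<and>
         (\<forall>(n::nat) (t :: nat \<Rightarrow> real ^ 'p) (x :: nat \<Rightarrow> real ^ 'd).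
           1 \<le> n \<longrightarrow> (\<forall>j\<in>{1..n}. \<forall>i. 0 < x j $ i) \<longrightarrow>
           (\<exists>f. distributed N (\<Pi>\<^sub>M j\<in>{1..n}. lborel) (\<lambda>\<omega>. \<lambda>j\<in>{1..n}. Y (t j) \<omega>) f) \<longrightarrow>
           (let J = (UNIV :: 'd set) \<times> {1..n} in
             - ln (\<P>(\<omega> in M. \<forall>j\<in>{1..n}. X (t j) \<omega> \<le> x j)) =
             (\<Sum>(k, l)\<in>J. 1 / (x l $ k) *
                \<P>(\<omega> in N. \<forall>(i, j)\<in>J - {(k, l)}.
                   Y (t j) \<omega> $ i - Y (t l) \<omega> $ k
                     - 1 / 2 * prob_space.variance N (\<lambda>\<omega>'. Y (t j) \<omega>' $ i - Y (t l) \<omega>' $ k)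
                   \<le> ln (x j $ i / x l $ k)))))"
proof (intro conjI allI impI)
  fix M' :: "'a2 measure" and X' and N' :: "'b2 measure" and Y' and P' :: "'q2 measure" and E' Zs'
  assume "brown_resnick M' X' N' Y' P' E' Zs'"
    and "\<forall>i j t s. pseudo_variogram N Y i j t s = pseudo_variogram N' Y' i j t s"
  then show "process_law M X = process_law M' X'"
    using brown_resnick_law_eq[OF assms, of M' X' N' Y' P' E' Zs' "\<lambda>t. t" "\<lambda>t. t"] by simp
next
  assume "\<exists>g. \<forall>i j t s. pseudo_variogram N Y i j t s = g i j (t - s)"
  then obtain g where "\<And>i j t s. pseudo_variogram N Y i j t s = g i j (t - s)" by blast
  \<comment> \<open>The process is compared with itself under a translation of time: differences are
    unchanged when both times are moved by the same \<open>h\<close>.\<close>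
  then show "stationary M X"
    unfolding stationary_def
    using brown_resnick_law_eq[OF assms assms, of "\<lambda>t. t - _" "\<lambda>t. t"] by simp
next
  fix n :: nat and t :: "nat \<Rightarrow> real ^ 'p" and x :: "nat \<Rightarrow> real ^ 'd"
  assume n: "1 \<le> n" and x: "\<forall>j\<in>{1..n}. \<forall>i. 0 < x j $ i"
    and "\<exists>f. distributed N (\<Pi>\<^sub>M j\<in>{1..n}. lborel) (\<lambda>\<omega>. \<lambda>j\<in>{1..n}. Y (t j) \<omega>) f"
  then obtain f where f: "distributed N (\<Pi>\<^sub>M j\<in>{1..n}. lborel) (\<lambda>\<omega>. \<lambda>j\<in>{1..n}. Y (t j) \<omega>) f" by blast
  define J where "J = (UNIV :: 'd set) \<times> {1..n}"
  have J: "finite J" "J \<noteq> {}" "\<forall>q\<in>J. 0 < x (snd q) $ fst q"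
    using n x by (auto simp: J_def)
  interpret G: centered_gaussian_family N "\<lambda>q \<omega>. Y (t (snd q)) \<omega> $ fst q"
    using assms by (intro centered_gaussian_family_components) (auto simp: brown_resnick_def)
  \<comment> \<open>This is where the density enters: it excludes ties between any two distinct
    pairs of \<open>J\<close>, including different components at the same time.\<close>
  have ties: "AE \<omega> in N. Y (t (snd p)) \<omega> $ fst p - Y (t (snd q)) \<omega> $ fst q \<noteq> c"
    if "p \<in> J" "q \<in> J" "p \<noteq> q" for p q c
    using distributed_component_difference[OF f, of "snd p" "snd q" "fst p" "fst q" c] that
    by (auto simp: J_def)
  have "{\<omega>\<in>space M. \<forall>j\<in>{1..n}. X (t j) \<omega> \<le> x j} = {\<omega>\<in>space M. \<forall>q\<in>J. X (t (snd q)) \<omega> $ fst q \<le> x (snd q) $ fst q}"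
    by (auto simp: J_def less_eq_vec_def)
  then have "- ln (\<P>(\<omega> in M. \<forall>j\<in>{1..n}. X (t j) \<omega> \<le> x j)) = G.expectation (G.spectral_max J (\<lambda>q. x (snd q) $ fst q))"
    using brown_resnick_cdf[OF assms J, of "\<lambda>q. t (snd q)" fst] by simp
  also have "\<dots> = (\<Sum>p\<in>J. 1 / x (snd p) $ fst p * G.prob {\<omega>\<in>space N. \<forall>q\<in>J - {p}.
      Y (t (snd q)) \<omega> $ fst q - Y (t (snd p)) \<omega> $ fst p
        - 1 / 2 * G.variance (\<lambda>\<omega>. Y (t (snd q)) \<omega> $ fst q - Y (t (snd p)) \<omega> $ fst p)
      \<le> ln (x (snd q) $ fst q / x (snd p) $ fst p)})"
    by (rule G.expectation_spectral_max_argmax[OF J ties])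
  also have "\<dots> = (\<Sum>(k, l)\<in>J. 1 / (x l $ k) *
                \<P>(\<omega> in N. \<forall>(i, j)\<in>J - {(k, l)}.
                   Y (t j) \<omega> $ i - Y (t l) \<omega> $ k
                     - 1 / 2 * prob_space.variance N (\<lambda>\<omega>'. Y (t j) \<omega>' $ i - Y (t l) \<omega>' $ k)
                   \<le> ln (x j $ i / x l $ k)))"
    by (simp add: split_def)
  finally show "let J = (UNIV :: 'd set) \<times> {1..n} in
             - ln (\<P>(\<omega> in M. \<forall>j\<in>{1..n}. X (t j) \<omega> \<le> x j)) =
             (\<Sum>(k, l)\<in>J. 1 / (x l $ k) *
                \<P>(\<omega> in N. \<forall>(i, j)\<in>J - {(k, l)}.
                   Y (t j) \<omega> $ i - Y (t l) \<omega> $ k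
                     - 1 / 2 * prob_space.variance N (\<lambda>\<omega>'. Y (t j) \<omega>' $ i - Y (t l) \<omega>' $ k)
                   \<le> ln (x j $ i / x l $ k)))"
    unfolding Let_def J_def .
qed

end
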